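(* For every real number $a\in[0,1]$, $$\int_0^1\frac{\mathbf K\big(2\sqrt{x(1-x)}\big)}{\sqrt{1-2(2x-1)a+a^{2}}}\,dx=\left[\mathbf K\left(\sqrt{\frac{1-\sqrt{1+a^{2}}}{2}}\right)\right]^2.$$
   Context: $\mathbf K(k)=\int_0^{\pi/2}\frac{d\theta}{\sqrt{1-k^2\sin^2\theta}}$ denotes the complete elliptic integral of the first kind with modulus $k$. It is effectively a function of $k^2$, so for negative $k^2$ it does not matter which branch of the square root is chosen for $k$; thus for real $m<1$ (possibly negative), $\mathbf K(\sqrt{m})=\int_0^{\pi/2}(1-m\sin^2\theta)^{-1/2}\,d\theta$. *)

theory Defs
  imports "HOL-Analysis.Analysis"
begin

text \<open>
  The modulus \<open>k\<close> is complex so that imaginary moduli (negative \<open>k\<^sup>2\<close>) are covered. Only \<open>k\<^sup>2\<close>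
  enters, so the choice of square root for \<open>k\<close> is irrelevant. When \<open>k\<^sup>2\<close> is real and less than 1, the
  radicand is a positive real and \<open>csqrt\<close> is the usual real square root. At \<open>k\<^sup>2 = 1\<close> the defining
  integral diverges and \<open>integral\<close> returns 0.
\<close>

definition ellipticK :: "complex \<Rightarrow> complex" where
  "ellipticK k =
     integral {0..pi/2} (\<lambda>\<theta>::real. 1 / csqrt (1 - k\<^sup>2 * (complex_of_real (sin \<theta>))\<^sup>2))"

end

theory Submission
  imports Defs "HOL-Complex_Analysis.Complex_Analysis"
begin

text \<open>
  Put \<open>w = a\<^sup>2\<close>, \<open>u = 2x - 1\<close> and \<open>c\<^sub>n = binomial (2n) n / 4^n\<close>. Since \<open>4x(1 - x) = 1 - u\<^sup>2\<close>, the left-hand side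
  integrates the complementary function \<open>K(sqrt(1 - u\<^sup>2))\<close>, which is even in \<open>u\<close>, against the Legendre
  kernel. Expanding both sides turns the theorem into an identity between hypergeometric series.

  The integral. Folding \<open>u\<close> and \<open>-u\<close> together and writing the kernel as
  \<open>(1 + w)^(-1/2) (1 - tu)^(-1/2)\<close> with \<open>t = 2a/(1 + w)\<close> leaves an even series in \<open>tu\<close> with nonnegative
  coefficients, so it may be integrated termwise for every \<open>a\<close> in \<open>[0,1]\<close>, the singular case \<open>a = 1\<close>
  included (\<open>nn_integral_complementary_K_generating\<close>). The moments needed are explicit: after a
  substitution, \<open>K(sqrt(1 - u\<^sup>2)) du\<close> is the image of the uniform measure on a square under
  \<open>(\<alpha>, \<beta>) \<mapsto> sin \<alpha> sin \<beta>\<close>, so that the moment of order \<open>2m\<close> is the square of a Wallis integral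
  (\<open>complementary_K_moment\<close>). Hence the left-hand side is
  \<open>(\<pi>/2)\<^sup>2 (1 + w)^(-1/2) \<Sum> q\<^sub>m (w/(1 + w)\<^sup>2)^m\<close> with \<open>q\<^sub>m = 4^m c\<^bsub>2m\<^esub> c\<^sub>m\<^sup>2\<close>.

  The right-hand side is \<open>(\<pi>/2)\<^sup>2 Y(z)\<^sup>2\<close> with \<open>Y(z) = \<Sum> c\<^sub>n\<^sup>2 z^n\<close> and \<open>z = (1 - sqrt(1 + w))/2\<close>
  (\<open>ellipticK_series\<close>); note that \<open>w = 4z(z - 1)\<close>.

  The series. With \<open>d\<^sub>n = ((1/4)\<^sub>n / n!)\<^sup>2\<close> three classical identities meet:
  \<open>(1 + w)^(-1/2) \<Sum> q\<^sub>m (w/(1 + w)\<^sup>2)^m = \<Sum> c\<^sub>n\<^sup>3 (-w)^n\<close> (a Saalschuetz sum),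
  \<open>\<Sum> c\<^sub>n\<^sup>3 (-w)^n = (\<Sum> d\<^sub>n (-w)^n)\<^sup>2\<close> (Clausen's formula), and
  \<open>\<Sum> d\<^sub>n (-w)^n = Y(z)\<close> (a quadratic transformation). Coefficientwise each of them is a terminating
  sum that satisfies a first-order recurrence by telescoping. As formal power series in \<open>z\<close> they
  combine to the required identity near \<open>z = 0\<close>.

  The domain. The rearrangement behind the first identity converges absolutely only for small \<open>w\<close>,
  whereas \<open>w\<close> ranges over \<open>[0,1]\<close>. As functions of \<open>z\<close> both sides are holomorphic in a complex
  neighbourhood of the segment \<open>(1 - sqrt 2)/2 < z \<le> 0\<close>, that is \<open>0 \<le> w < 1\<close>, because there
  \<open>w/(1 + w)\<^sup>2 < 1/4\<close>; the identity theorem extends the equality to the segment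
  (\<open>moment_identity_real\<close>), and continuity to its end point \<open>w = 1\<close> (\<open>moment_series_eq_square\<close>).
\<close>

section \<open>Three terminating hypergeometric sums\<close>

text \<open>
  This is \<open>binomial (2n) n / 4^n\<close>, the coefficient of \<open>x^n\<close> in \<open>(1 - x)^(-1/2)\<close>; the form with a rising
  factorial makes the recurrence immediate.
\<close>

definition central_coeff :: "nat \<Rightarrow> real" where
  "central_coeff n = pochhammer (1/2) n / fact n"

text \<open>
  The coefficients of the hypergeometric series \<open>F(1/4, 1/4; 1; x)\<close>.
\<close>

definition quarter_coeff :: "nat \<Rightarrow> real" where
  "quarter_coeff n = (pochhammer (1/4) n / fact n)\<^sup>2"

text \<open>
  One factor \<open>central_coeff (2 * m)\<close> comes from the Legendre kernel, the square from the moment of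
  order \<open>2m\<close>, and \<open>4^m\<close> from \<open>t\<^sup>2 = 4 w / (1 + w)\<^sup>2\<close> with \<open>w = a\<^sup>2\<close> and \<open>t = 2 a / (1 + w)\<close>.
\<close>

definition moment_coeff :: "nat \<Rightarrow> real" where
  "moment_coeff m = 4 ^ m * central_coeff (2 * m) * (central_coeff m)\<^sup>2"

lemma central_coeff_0 [simp]: "central_coeff 0 = 1"
  by (simp add: central_coeff_def)

lemma quarter_coeff_0 [simp]: "quarter_coeff 0 = 1"
  by (simp add: quarter_coeff_def)

lemma central_coeff_Suc: "central_coeff (Suc n) = central_coeff n * ((real n + 1/2) / (real n + 1))"
  by (simp add: central_coeff_def pochhammer_rec' field_simps)

lemma quarter_coeff_Suc:
  "quarter_coeff (Suc n) = quarter_coeff n * ((real n + 1/4) / (real n + 1))\<^sup>2"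
proof -
  have "pochhammer (1/4) (Suc n) / fact (Suc n) =
          pochhammer (1/4) n / fact n * ((real n + 1/4) / (real n + 1))"
    by (simp add: pochhammer_rec' field_simps)
  thus ?thesis
    by (simp only: quarter_coeff_def power_mult_distrib)
qed

lemma central_coeff_pos: "central_coeff n > 0"
  by (simp add: central_coeff_def pochhammer_pos)

text \<open>
  All three sums below are evaluated through this uniqueness principle for a first-order recurrence.
\<close>

lemma central_coeff_power_recurrence:
  assumes "S 0 = 1"
    and "\<And>n. (real n + 1) ^ p * S (Suc n) = (real n + 1/2) ^ p * S n"
  shows "S n = central_coeff n ^ p"
proof (induction n)
  case (Suc n)
  have "S (Suc n) = S n * ((real n + 1/2) / (real n + 1)) ^ p"
  proof -
    have "s' = s * (x / y) ^ p" if "y \<noteq> 0" "y ^ p * s' = x ^ p * s" for x y s s' :: real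
      using that by (simp add: power_divide field_simps)
    from this[OF _ assms(2)[of n]] show ?thesis by simp
  qed
  thus ?case
    by (simp only: Suc central_coeff_Suc power_mult_distrib)
qed (use assms(1) in simp)

lemma binomial_absorb_comp_real:
  "(real n + 1 - real m) * real (Suc n choose m) = (real n + 1) * real (n choose m)"
  using gbinomial_absorb_comp[of "real (Suc n)" m] by (simp add: binomial_gbinomial add_ac)

text \<open>
  In this and the next identity (and in \<open>saalschuetz_certificate\<close>) the left-hand side is the
  recurrence applied to one summand and the right-hand side is the difference of the telescoping
  function at consecutive arguments, up to
  hypergeometric factors common to both. The telescoping functions come from Zeilberger's method:
  a rational multiple of the summand with undetermined coefficients.
\<close>

lemma convolution_certificate:
  fixes k i A B :: real
  shows "(k + i + 1) ^ 3 * (B * (k + 1)\<^sup>2 * (A * (i + 1/4)\<^sup>2)) -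
         (k + i + 1/2) ^ 3 * (B * (k + 1)\<^sup>2 * (A * (i + 1)\<^sup>2)) =
         (1 + k)\<^sup>2 * (2 * (1 + k) - 3 * (k + i) - 3) * (B * (k + 1/4)\<^sup>2) * (A * (i + 1)\<^sup>2) -
         k\<^sup>2 * (2 * k - 3 * (k + i) - 3) * (B * (k + 1)\<^sup>2) * (A * (i + 1/4)\<^sup>2)"
  by algebra

lemma quadratic_certificate:
  fixes k j :: real
  shows "(k + j + 1)\<^sup>2 * (4 * (k + 1/4)\<^sup>2 * (k + 1)) - (k + j + 1/2)\<^sup>2 * ((k + 1)\<^sup>2 * (k + 1 - j)) =
         (3 * k + j + 1) * ((k + 1)\<^sup>2 * ((k + 1 - j) * (k - j))) +
         (3 * k + j + 3) * j * (4 * (k + 1/4)\<^sup>2 * (k + 1))"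
  by algebra

text \<open>
  Clausen's formula for \<open>F(1/4, 1/4; 1; x)\<^sup>2\<close>, read off coefficientwise.
\<close>

lemma sum_quarter_coeff_convolution:
  "(\<Sum>k\<le>n. quarter_coeff k * quarter_coeff (n - k)) = central_coeff n ^ 3"
proof (rule central_coeff_power_recurrence)
  fix n :: nat
  define N where "N = real n"
  define G where "G = (\<lambda>k::nat. real k ^ 2 * (2 * real k - 3 * N - 3) * quarter_coeff k * quarter_coeff (Suc n - k))"
  have "(N + 1) ^ 3 * (quarter_coeff k * quarter_coeff (Suc n - k))
        - (N + 1/2) ^ 3 * (quarter_coeff k * quarter_coeff (n - k)) = G (Suc k) - G k"
    if k: "k \<in> {..n}" for k
  proof -
    obtain i where n: "n = k + i" using k le_Suc_ex[of k n] by auto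
    have *: "Suc (k + i) - k = Suc i" "k + i - k = i" "Suc (k + i) - Suc k = i" by auto
    have nz: "real i + 1 \<noteq> 0" "real k + 1 \<noteq> 0" by auto
    define A B where "A = quarter_coeff i / (real i + 1)\<^sup>2" and "B = quarter_coeff k / (real k + 1)\<^sup>2"
    have q: "quarter_coeff i = A * (real i + 1)\<^sup>2" "quarter_coeff (Suc i) = A * (real i + 1/4)\<^sup>2"
            "quarter_coeff k = B * (real k + 1)\<^sup>2" "quarter_coeff (Suc k) = B * (real k + 1/4)\<^sup>2"
      using nz by (simp_all add: A_def B_def quarter_coeff_Suc power_divide)
    show ?thesis
      unfolding n G_def N_def * q of_nat_add of_nat_Suc
      using convolution_certificate[of "real k" "real i" B A] by simp
  qed
  hence "(\<Sum>k\<le>n. (N + 1) ^ 3 * (quarter_coeff k * quarter_coeff (Suc n - k))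
        - (N + 1/2) ^ 3 * (quarter_coeff k * quarter_coeff (n - k))) = (\<Sum>k\<le>n. G (Suc k) - G k)"
    by (rule sum.cong[OF refl])
  also have "\<dots> = G (Suc n) - G 0"
    by (simp only: lessThan_Suc_atMost [symmetric] sum_lessThan_telescope)
  also have "\<dots> = - ((N + 1) ^ 3 * quarter_coeff (Suc n))"
    by (simp add: G_def N_def power3_eq_cube power2_eq_square algebra_simps)
  finally have "(N + 1) ^ 3 * (\<Sum>k\<le>n. quarter_coeff k * quarter_coeff (Suc n - k))
        - (N + 1/2) ^ 3 * (\<Sum>k\<le>n. quarter_coeff k * quarter_coeff (n - k)) =
        - ((N + 1) ^ 3 * quarter_coeff (Suc n))"
    unfolding sum_subtractf sum_distrib_left [symmetric] .
  moreover have "(\<Sum>k\<le>Suc n. quarter_coeff k * quarter_coeff (Suc n - k)) =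
        (\<Sum>k\<le>n. quarter_coeff k * quarter_coeff (Suc n - k)) + quarter_coeff (Suc n)"
    by simp
  ultimately show "(real n + 1) ^ 3 * (\<Sum>k\<le>Suc n. quarter_coeff k * quarter_coeff (Suc n - k)) =
         (real n + 1/2) ^ 3 * (\<Sum>k\<le>n. quarter_coeff k * quarter_coeff (n - k))"
    unfolding N_def by (simp only: distrib_left)
qed simp

text \<open>
  The coefficients of the quadratic transformation
  \<open>F(1/4, 1/4; 1; 4z(1 - z)) = F(1/2, 1/2; 1; z)\<close>.
\<close>

lemma sum_quarter_coeff_quadratic:
  "(\<Sum>j\<le>n. quarter_coeff (n - j) * 4 ^ (n - j) * (-1) ^ j * real ((n - j) choose j)) = (central_coeff n)\<^sup>2"
proof (rule central_coeff_power_recurrence)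
  fix n :: nat
  define N where "N = real n"
  define F where "F = (\<lambda>n j. quarter_coeff (n - j) * 4 ^ (n - j) * (-1) ^ j * real ((n - j) choose j))"
  define G where "G = (\<lambda>j::nat. (2 * real j - 3 * (N + 1)) * real j * F (Suc n) j)"
  have "(N + 1) ^ 2 * F (Suc n) j - (N + 1/2) ^ 2 * F n j = G (Suc j) - G j"
    if j: "j \<in> {..n}" for j
  proof -
    obtain k where n: "n = k + j" using j le_Suc_ex[of j n] by (auto simp: add.commute)
    have *: "Suc (k + j) - j = Suc k" "k + j - j = k" "Suc (k + j) - Suc j = k" by auto
    define B where "B = real (Suc k choose j)"
    have b1: "real (k choose j) * (real k + 1) = B * (real k + 1 - real j)"
      using binomial_absorb_comp_real[of k j] by (simp only: B_def mult.commute)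
    have b2: "real (k choose Suc j) * (real j + 1) = real (k choose j) * (real k - real j)"
      using gbinomial_absorption[of j "real k"] gbinomial_absorb_comp[of "real k" j]
      by (simp add: binomial_gbinomial algebra_simps)
    have nz: "real k + 1 \<noteq> 0" by auto
    \<comment> \<open>Dividing out the denominators of \<open>quarter_coeff (Suc k)\<close> and of the absorption identity turns
        all terms into polynomial multiples of \<open>D * E\<close>.\<close>
    define D E where "D = quarter_coeff k / (real k + 1)\<^sup>2" and "E = B / (real k + 1)"
    have q: "quarter_coeff k = D * (real k + 1)\<^sup>2" "quarter_coeff (Suc k) = D * (real k + 1/4)\<^sup>2"
      using nz by (simp_all add: D_def quarter_coeff_Suc power_divide)
    have e: "B = E * (real k + 1)" "real (k choose j) = E * (real k + 1 - real j)"
      using nz b1 by (simp_all add: E_def field_simps)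
    have e': "real (k choose Suc j) = E * (real k + 1 - real j) * (real k - real j) / (real j + 1)"
      using b2 unfolding e by (simp add: field_simps)
    define P where "P = D * E * 4 ^ k * (-1) ^ j"
    have "(N + 1)\<^sup>2 * F (Suc n) j - (N + 1/2)\<^sup>2 * F n j =
            P * ((real k + real j + 1)\<^sup>2 * (4 * (real k + 1/4)\<^sup>2 * (real k + 1)) -
                 (real k + real j + 1/2)\<^sup>2 * ((real k + 1)\<^sup>2 * (real k + 1 - real j)))"
      unfolding n F_def N_def * q e B_def [symmetric] of_nat_add P_def right_diff_distrib
      by (simp add: mult_ac)
    also have "\<dots> = P * ((3 * real k + real j + 1) * ((real k + 1)\<^sup>2 * ((real k + 1 - real j) * (real k - real j))) +
         (3 * real k + real j + 3) * real j * (4 * (real k + 1/4)\<^sup>2 * (real k + 1)))"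
      unfolding quadratic_certificate ..
    also have "\<dots> = G (Suc j) - G j"
    proof -
      have "G (Suc j) = P * ((3 * real k + real j + 1) * ((real k + 1)\<^sup>2 * ((real k + 1 - real j) * (real k - real j))))"
      proof -
        have c: "2 * (1 + real j) - 3 * (real k + real j + 1) = - (3 * real k + real j + 1)"
          by simp
        have rearrange: "- c * J * (d * K * f * (-1 * s) * (e * a * b / J)) = d * e * f * s * (c * (K * (a * b)))"
          if "J \<noteq> 0" for c J d K f s e a b :: real
          using that by simp
        show ?thesis
          unfolding n G_def F_def N_def * q e' of_nat_add of_nat_Suc P_def c power_Suc
          unfolding add.commute [of 1 "real j"]
          by (rule rearrange) auto
      qed
      moreover have "G j = - (P * ((3 * real k + real j + 3) * real j * (4 * (real k + 1/4)\<^sup>2 * (real k + 1))))"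
      proof -
        have c: "2 * real j - 3 * (real k + real j + 1) = - (3 * real k + real j + 3)"
          by simp
        have rearrange: "- c * J * (d * a * (4 * f) * s * (e * K)) = - (d * e * f * s * (c * J * (4 * a * K)))"
          for c J d K f s e a :: real
          by simp
        show ?thesis
          unfolding n G_def F_def N_def * q B_def [symmetric] e of_nat_add P_def c power_Suc
          by (rule rearrange)
      qed
      ultimately show ?thesis by (simp add: distrib_left)
    qed
    finally show ?thesis .
  qed
  hence "(\<Sum>j\<le>n. (N + 1) ^ 2 * F (Suc n) j - (N + 1/2) ^ 2 * F n j) = (\<Sum>j\<le>n. G (Suc j) - G j)"
    by (rule sum.cong[OF refl])
  also have "\<dots> = G (Suc n) - G 0"
    by (simp only: lessThan_Suc_atMost [symmetric] sum_lessThan_telescope)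
  also have "\<dots> = 0"
    by (simp add: G_def F_def)
  finally have "(real n + 1) ^ 2 * (\<Sum>j\<le>Suc n. F (Suc n) j) = (real n + 1/2) ^ 2 * (\<Sum>j\<le>n. F n j)"
    by (simp add: sum_subtractf sum_distrib_left N_def F_def algebra_simps)
  thus "(real n + 1) ^ 2 * (\<Sum>j\<le>Suc n. quarter_coeff (Suc n - j) * 4 ^ (Suc n - j) * (-1) ^ j * real ((Suc n - j) choose j)) =
         (real n + 1/2) ^ 2 * (\<Sum>j\<le>n. quarter_coeff (n - j) * 4 ^ (n - j) * (-1) ^ j * real ((n - j) choose j))"
    by (simp add: F_def)
qed simp

lemma saalschuetz_certificate:
  fixes n m :: real
  shows "(n + 1) ^ 3 * (n + m + 1/2) - (n + 1/2) ^ 3 * (n + 1 - m) =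
         (2 * n + 3/2) * ((n + 1 - m) * (m + 1/2) * (n + m + 1/2)) - (- (2 * n + 3/2) * m ^ 3)"
  by algebra

text \<open>
  Up to the factor \<open>pochhammer (1/2) n / fact n\<close> this is the balanced series
  \<open>3F2(-n, n + 1/2, 1/2; 1, 1; 1)\<close>, which the Pfaff--Saalschuetz theorem sums.
\<close>

lemma sum_saalschuetz:
  "(\<Sum>m\<le>n. (-1) ^ m * pochhammer (1/2) m * pochhammer (1/2) (n + m) * real (n choose m) /
           (fact n * (fact m)\<^sup>2)) = central_coeff n ^ 3"
proof (rule central_coeff_power_recurrence)
  fix n :: nat
  define N where "N = real n"
  define T :: "nat \<Rightarrow> nat \<Rightarrow> real"
    where "T = (\<lambda>n m. (-1) ^ m * pochhammer (1/2) m * pochhammer (1/2) (n + m) * real (n choose m) /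
           (fact n * (fact m)\<^sup>2))"
  define X :: "nat \<Rightarrow> real"
    where "X = (\<lambda>m. (-1) ^ m * pochhammer (1/2) m * pochhammer (1/2) (n + m) / (fact n * (fact m)\<^sup>2))"
  \<comment> \<open>The factor \<open>1 / (n + 1 - m)\<close> of the telescoping function is absorbed into
      \<open>Suc n choose m\<close>, so that no denominator vanishes on the range of summation.\<close>
  define G where "G = (\<lambda>m. - (2 * N + 3/2) * real m ^ 3 * X m * real (Suc n choose m) / (N + 1))"
  have "(N + 1) ^ 3 * T (Suc n) m - (N + 1/2) ^ 3 * T n m = G (Suc m) - G m" for m
  proof -
    define M where "M = real m"
    have nz: "N + 1 \<noteq> 0" "M + 1 \<noteq> 0" by (auto simp: N_def M_def add_nonneg_eq_0_iff)
    define E where "E = real (Suc n choose m) / (N + 1)"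
    have e: "real (Suc n choose m) = E * (N + 1)"
      using nz by (simp add: E_def)
    have e1: "real (n choose m) = E * (N + 1 - M)"
    proof -
      have "(N + 1) * real (n choose m) = (N + 1) * (E * (N + 1 - M))"
        using binomial_absorb_comp_real[of n m] by (simp only: N_def [symmetric] M_def [symmetric] e mult_ac)
      thus ?thesis using nz by simp
    qed
    have e2: "real (Suc n choose Suc m) = E * (N + 1) * (N + 1 - M) / (M + 1)"
    proof -
      have "real (Suc m * (Suc n choose Suc m)) = real (Suc n * (n choose m))"
        by (simp only: Suc_times_binomial)
      hence "(M + 1) * real (Suc n choose Suc m) = (N + 1) * (E * (N + 1 - M))"
        by (simp only: of_nat_mult of_nat_Suc N_def M_def e1 add.commute)
      thus ?thesis
        using nz by (simp add: eq_divide_eq mult_ac)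
    qed
    have T1: "T (Suc n) m = X m * E * (N + M + 1/2)"
    proof -
      have "pochhammer (1/2) (Suc n + m) = pochhammer (1/2) (n + m) * (N + M + 1/2)"
        using pochhammer_rec'[of "1/2 :: real" "n + m"] unfolding add_Suc of_nat_add N_def M_def
        by (simp only: add_ac mult_ac)
      moreover have "(fact (Suc n) :: real) = fact n * (N + 1)"
        by (simp add: N_def)
      ultimately show ?thesis
        unfolding T_def X_def e using nz by (simp only:) (simp add: mult_ac)
    qed
    have T0: "T n m = X m * E * (N + 1 - M)"
      unfolding T_def X_def e1 by simp
    have X1: "X (Suc m) = - X m * (M + 1/2) * (N + M + 1/2) / (M + 1)\<^sup>2"
    proof -
      have "pochhammer (1/2) (n + Suc m) = pochhammer (1/2) (n + m) * (N + M + 1/2)"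
        "pochhammer (1/2) (Suc m) = pochhammer (1/2) m * (M + 1/2)"
        using pochhammer_rec'[of "1/2 :: real" "n + m"] pochhammer_rec'[of "1/2 :: real" m]
        unfolding add_Suc_right of_nat_add N_def M_def by (simp_all only: add_ac mult_ac)
      moreover have "(fact (Suc m) :: real) = fact m * (M + 1)"
        by (simp add: M_def)
      ultimately show ?thesis
        unfolding X_def using nz by (simp only:) (simp add: power_mult_distrib mult_ac)
    qed
    have G1: "G (Suc m) = X m * E * ((2 * N + 3/2) * ((N + 1 - M) * (M + 1/2) * (N + M + 1/2)))"
    proof -
      have M1: "real (Suc m) = M + 1" by (simp add: M_def)
      have rearrange: "- c * J ^ 3 * (- x * a * b / J\<^sup>2) * (e * K * d / J) / K = x * e * (c * (d * a * b))"
        if "J \<noteq> 0" "K \<noteq> 0" for c J x a b e K d :: real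
        using that by (simp add: power2_eq_square power3_eq_cube)
      show ?thesis
        unfolding G_def X1 e2 M1 by (rule rearrange) (use nz in auto)
    qed
    have G0: "G m = X m * E * (- (2 * N + 3/2) * M ^ 3)"
      unfolding G_def e M_def [symmetric] using nz by simp
    have "(N + 1) ^ 3 * T (Suc n) m - (N + 1/2) ^ 3 * T n m =
          X m * E * ((N + 1) ^ 3 * (N + M + 1/2) - (N + 1/2) ^ 3 * (N + 1 - M))"
      unfolding T1 T0 right_diff_distrib by (simp only: mult_ac)
    also have "\<dots> = G (Suc m) - G m"
      unfolding saalschuetz_certificate G1 G0 right_diff_distrib [of "X m * E"] ..
    finally show ?thesis .
  qed
  hence "(\<Sum>m\<le>Suc n. (N + 1) ^ 3 * T (Suc n) m - (N + 1/2) ^ 3 * T n m) = (\<Sum>m\<le>Suc n. G (Suc m) - G m)"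
    by simp
  also have "\<dots> = G (Suc (Suc n)) - G 0"
    by (simp only: lessThan_Suc_atMost [symmetric] sum_lessThan_telescope)
  also have "\<dots> = 0"
    by (simp add: G_def binomial_eq_0)
  finally have "(N + 1) ^ 3 * (\<Sum>m\<le>Suc n. T (Suc n) m) = (N + 1/2) ^ 3 * (\<Sum>m\<le>Suc n. T n m)"
    by (simp only: sum_subtractf sum_distrib_left right_minus_eq)
  also have "(\<Sum>m\<le>Suc n. T n m) = (\<Sum>m\<le>n. T n m)"
    by (simp add: T_def)
  finally show "(real n + 1) ^ 3 * (\<Sum>m\<le>Suc n. (-1) ^ m * pochhammer (1/2) m * pochhammer (1/2) (Suc n + m) *
        real (Suc n choose m) / (fact (Suc n) * (fact m)\<^sup>2)) =
      (real n + 1/2) ^ 3 * (\<Sum>m\<le>n. (-1) ^ m * pochhammer (1/2) m * pochhammer (1/2) (n + m) * real (n choose m) /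
           (fact n * (fact m)\<^sup>2))"
    unfolding T_def N_def .
qed simp

text \<open>
  The left-hand side is the coefficient of \<open>w^n\<close> in \<open>(1 + w)^(-1/2) * \<Sum> q\<^sub>m (w/(1 + w)\<^sup>2)^m\<close>,
  where \<open>q\<^sub>m\<close> is \<open>moment_coeff m\<close>.
\<close>

lemma sum_moment_coeff_gbinomial:
  "(\<Sum>m\<le>n. moment_coeff m * ((- (1/2) - 2 * real m) gchoose (n - m))) = (-1) ^ n * central_coeff n ^ 3"
proof -
  have "moment_coeff m * ((- (1/2) - 2 * real m) gchoose (n - m)) =
        (-1) ^ n * ((-1) ^ m * pochhammer (1/2) m * pochhammer (1/2) (n + m) * real (n choose m) /
           (fact n * (fact m)\<^sup>2))" if m: "m \<le> n" for m
  proof -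
    obtain i where n: "n = m + i" using m le_Suc_ex by blast
    have p: "pochhammer (1/2) (2 * m) * pochhammer (1/2 + 2 * real m) i = pochhammer (1/2) (n + m)"
    proof -
      have "m + i + m = 2 * m + i" by simp
      thus ?thesis
        using pochhammer_product'[of "1/2 :: real" "2 * m" i]
        unfolding n \<open>m + i + m = 2 * m + i\<close> by (simp only: of_nat_mult of_nat_numeral)
    qed
    have f: "(fact (2 * m) :: real) = 4 ^ m * pochhammer (1/2) m * fact m"
      using fact_double[of m, where 'a = real] by (simp add: power_mult)
    have b: "real (n choose m) / fact n = 1 / (fact m * fact i)"
      by (simp add: n binomial_fact)
    have g: "(- (1/2) - 2 * real m) gchoose i = (-1) ^ i * pochhammer (1/2 + 2 * real m) i / fact i"
      by (simp add: gbinomial_pochhammer add.commute)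
    have s: "(-1) ^ i = (-1) ^ n * ((-1) ^ m :: real)"
      by (simp add: n power_add)
    have pp: "pochhammer (1/2 :: real) m > 0" by (rule pochhammer_pos) simp
    have rearrange: "q * (P / (q * p * f)) * (p / f)\<^sup>2 * (\<sigma> * Q / g) = \<sigma> * p * (P * Q) / f\<^sup>2 * (1 / (f * g))"
      if "q \<noteq> 0" "p \<noteq> 0" for q P p f \<sigma> Q g :: real
      using that by (simp add: power2_eq_square mult_ac)
    have "moment_coeff m * ((- (1/2) - 2 * real m) gchoose (n - m)) =
      (-1) ^ i * pochhammer (1/2) m * (pochhammer (1/2) (2 * m) * pochhammer (1/2 + 2 * real m) i) /
       ((fact m)\<^sup>2) * (1 / (fact m * fact i))"
    proof -
      have "n - m = i" by (simp add: n)
      show ?thesis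
        unfolding \<open>n - m = i\<close> moment_coeff_def central_coeff_def f g by (rule rearrange) (use pp in auto)
    qed
    also have "\<dots> = (-1) ^ n * ((-1) ^ m * pochhammer (1/2) m * pochhammer (1/2) (n + m) * real (n choose m) /
           (fact n * (fact m)\<^sup>2))"
      unfolding p s b [symmetric] by (simp add: mult_ac)
    finally show ?thesis .
  qed
  hence "(\<Sum>m\<le>n. moment_coeff m * ((- (1/2) - 2 * real m) gchoose (n - m))) =
    (\<Sum>m\<le>n. (-1) ^ n * ((-1) ^ m * pochhammer (1/2) m * pochhammer (1/2) (n + m) * real (n choose m) /
           (fact n * (fact m)\<^sup>2)))"
    by (intro sum.cong) auto
  thus ?thesis
    unfolding sum_distrib_left [symmetric] sum_saalschuetz .
qed

section \<open>The same identities for formal power series\<close>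

definition moment_fps :: "complex fps" where
  "moment_fps = Abs_fps (\<lambda>m. of_real (moment_coeff m))"

text \<open>
  The signs make this the expansion of \<open>F(1/4, 1/4; 1; -w)\<close> in \<open>w\<close>.
\<close>

definition quarter_fps :: "complex fps" where
  "quarter_fps = Abs_fps (\<lambda>n. of_real ((-1) ^ n * quarter_coeff n))"

text \<open>
  This series represents \<open>2/\<pi> * K(k)\<close> in the variable \<open>k\<^sup>2\<close>.
\<close>

definition K_fps :: "complex fps" where
  "K_fps = Abs_fps (\<lambda>n. of_real ((central_coeff n)\<^sup>2))"

lemma of_real_gbinomial: "(of_real x gchoose n :: 'a :: real_normed_field) = of_real (x gchoose n)"
  by (simp add: gbinomial_prod_rev)

lemma fps_mult_compose_nth:
  fixes f g h :: "'a :: comm_ring_1 fps"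
  assumes "fps_nth g 0 = 0"
  shows "(h * (f oo g)) $ n = (\<Sum>i\<le>n. f $ i * (h * g ^ i) $ n)"
proof -
  have *: "(f oo g) $ l = (\<Sum>i\<le>n. f $ i * (g ^ i) $ l)" if "l \<le> n" for l
  proof -
    have "(g ^ i) $ l = 0" if "l < i" for i
      using startsby_zero_power_prefix[OF assms, of i] that by blast
    hence "(\<Sum>i=0..l. f $ i * (g ^ i) $ l) = (\<Sum>i\<le>n. f $ i * (g ^ i) $ l)"
      using \<open>l \<le> n\<close> by (intro sum.mono_neutral_left) auto
    thus ?thesis by (simp add: fps_compose_nth)
  qed
  have "(h * (f oo g)) $ n = (\<Sum>k=0..n. h $ k * (\<Sum>i\<le>n. f $ i * (g ^ i) $ (n - k)))"
    unfolding fps_mult_nth by (intro sum.cong) (auto simp: *)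
  also have "\<dots> = (\<Sum>i\<le>n. f $ i * (\<Sum>k=0..n. h $ k * (g ^ i) $ (n - k)))"
    unfolding sum_distrib_left by (subst sum.swap) (simp add: mult_ac)
  finally show ?thesis
    by (simp add: fps_mult_nth)
qed

text \<open>
  The Saalschuetz sum and Clausen's formula together: both sides have the coefficients
  \<open>(-1)^n * central_coeff n ^ 3\<close>.
\<close>

lemma moment_fps_compose:
  "fps_binomial (-1/2) * (moment_fps oo (fps_X * fps_binomial (-2))) = quarter_fps\<^sup>2"
proof (rule fps_ext)
  fix n
  have "(fps_binomial (-1/2) * (moment_fps oo (fps_X * fps_binomial (-2)))) $ n =
        (\<Sum>m\<le>n. moment_fps $ m * (fps_binomial (-1/2) * (fps_X * fps_binomial (-2)) ^ m) $ n)"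
    by (rule fps_mult_compose_nth) simp
  also have "\<dots> = (\<Sum>m\<le>n. of_real (moment_coeff m * ((- (1/2) - 2 * real m) gchoose (n - m))))"
  proof (rule sum.cong)
    fix m assume "m \<in> {..n}"
    hence m: "m \<le> n" by simp
    have "fps_binomial (-1/2) * (fps_X * fps_binomial (-2)) ^ m =
          fps_X ^ m * (fps_binomial (-1/2) * fps_binomial (of_nat m * (-2)) :: complex fps)"
      by (simp add: power_mult_distrib fps_binomial_power mult_ac)
    also have "fps_binomial (-1/2) * fps_binomial (of_nat m * (-2)) =
               (fps_binomial (of_real (- (1/2) - 2 * real m)) :: complex fps)"
      by (simp add: fps_binomial_add_mult [symmetric] mult.commute)
    finally have "(fps_binomial (-1/2) * (fps_X * fps_binomial (-2)) ^ m) $ n =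
        (of_real (- (1/2) - 2 * real m) gchoose (n - m) :: complex)"
      using m by (simp add: fps_X_power_mult_nth)
    thus "moment_fps $ m * (fps_binomial (-1/2) * (fps_X * fps_binomial (-2)) ^ m) $ n =
          of_real (moment_coeff m * ((- (1/2) - 2 * real m) gchoose (n - m)))"
      by (simp only: of_real_gbinomial of_real_mult moment_fps_def fps_nth_Abs_fps)
  qed simp
  also have "\<dots> = of_real ((-1) ^ n * central_coeff n ^ 3)"
    by (simp only: of_real_sum [symmetric] sum_moment_coeff_gbinomial)
  also have "\<dots> = (\<Sum>k\<le>n. quarter_fps $ k * quarter_fps $ (n - k))"
  proof -
    have "quarter_fps $ k * quarter_fps $ (n - k) =
          of_real ((-1) ^ n * (quarter_coeff k * quarter_coeff (n - k)))" if "k \<in> {..n}" for k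
    proof -
      have "(-1 :: real) ^ n = (-1) ^ k * (-1) ^ (n - k)"
        using that by (simp add: power_add [symmetric])
      thus ?thesis
        by (simp add: quarter_fps_def)
    qed
    hence "(\<Sum>k\<le>n. quarter_fps $ k * quarter_fps $ (n - k)) =
           of_real (\<Sum>k\<le>n. (-1) ^ n * (quarter_coeff k * quarter_coeff (n - k)))"
      unfolding of_real_sum by (rule sum.cong [OF refl])
    thus ?thesis
      by (simp only: sum_distrib_left [symmetric] sum_quarter_coeff_convolution)
  qed
  also have "\<dots> = (quarter_fps\<^sup>2) $ n"
    by (simp add: power2_eq_square fps_mult_nth atLeast0AtMost)
  finally show "(fps_binomial (-1/2) * (moment_fps oo (fps_X * fps_binomial (-2)))) $ n = (quarter_fps\<^sup>2) $ n" .
qed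

lemma quarter_fps_compose:
  "quarter_fps oo (fps_const 4 * fps_X * (fps_X - 1)) = K_fps"
proof (rule fps_ext)
  fix n
  have pow: "(fps_const 4 * fps_X * (fps_X - 1)) ^ i = fps_const ((-4) ^ i) * (fps_X ^ i * (1 - fps_X) ^ i :: complex fps)" for i
  proof -
    have "fps_const 4 * fps_X * (fps_X - 1) = fps_const (-4) * (fps_X * (1 - fps_X) :: complex fps)"
      by (simp add: fps_const_neg [symmetric] algebra_simps del: fps_const_neg)
    thus ?thesis
      by (simp only: power_mult_distrib fps_const_power)
  qed
  have one_minus: "(1 - fps_X :: complex fps) ^ i $ l = (-1) ^ l * of_nat (i choose l)" for i l
  proof (induction i arbitrary: l)
    case 0
    show ?case by (cases l) auto
  next
    case (Suc i)
    show ?case by (cases l) (simp_all add: Suc left_diff_distrib algebra_simps)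
  qed
  have "(quarter_fps oo (fps_const 4 * fps_X * (fps_X - 1))) $ n =
       (\<Sum>i=0..n. quarter_fps $ i * ((-4) ^ i * ((-1) ^ (n - i) * of_nat (i choose (n - i)))))"
    unfolding fps_compose_nth pow
    by (intro sum.cong) (simp_all add: fps_X_power_mult_nth one_minus)
  also have "\<dots> = of_real (\<Sum>i=0..n. quarter_coeff i * 4 ^ i * (-1) ^ (n - i) * real (i choose (n - i)))"
    unfolding of_real_sum
  proof (rule sum.cong)
    fix i
    have "(-1) ^ i * (-4) ^ i = (4 ^ i :: complex)"
      by (simp add: power_mult_distrib [symmetric])
    thus "quarter_fps $ i * ((-4) ^ i * ((-1) ^ (n - i) * of_nat (i choose (n - i)))) =
          of_real (quarter_coeff i * 4 ^ i * (-1) ^ (n - i) * real (i choose (n - i)))"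
      by (simp add: quarter_fps_def)
  qed simp
  also have "(\<Sum>i=0..n. quarter_coeff i * 4 ^ i * (-1) ^ (n - i) * real (i choose (n - i))) =
     (\<Sum>j\<le>n. quarter_coeff (n - j) * 4 ^ (n - j) * (-1) ^ j * real ((n - j) choose j))"
    by (rule sum.reindex_bij_witness [of _ "\<lambda>j. n - j" "\<lambda>j. n - j"]) auto
  also have "of_real \<dots> = K_fps $ n"
    by (simp add: sum_quarter_coeff_quadratic K_fps_def)
  finally show "(quarter_fps oo (fps_const 4 * fps_X * (fps_X - 1))) $ n = K_fps $ n" .
qed

section \<open>Growth of the coefficients\<close>

text \<open>
  The left-hand side decreases with \<open>n\<close>, because \<open>(n + 1/2)(n + 3/2) \<le> (n + 1)\<^sup>2\<close>. This gives
  \<open>central_coeff n = O(n^(-1/2))\<close> without Stirling's formula.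
\<close>

lemma central_coeff_bound: "(central_coeff n)\<^sup>2 * (2 * real n + 1) \<le> 1"
proof (induction n)
  case (Suc n)
  have "(central_coeff (Suc n))\<^sup>2 * (2 * real (Suc n) + 1) =
        ((central_coeff n)\<^sup>2 * (2 * real n + 1)) * (((real n + 1/2) * (real n + 3/2)) / (real n + 1)\<^sup>2)"
    by (simp add: central_coeff_Suc power2_eq_square field_simps)
  also have "\<dots> \<le> 1 * 1"
  proof (rule mult_mono)
    have "(real n + 1/2) * (real n + 3/2) \<le> (real n + 1)\<^sup>2"
      by (simp add: power2_eq_square algebra_simps)
    thus "((real n + 1/2) * (real n + 3/2)) / (real n + 1)\<^sup>2 \<le> 1"
      by (simp add: divide_le_eq)
  qed (use Suc in auto)
  finally show ?case by simp
qed simp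

lemma central_coeff_le_1: "central_coeff n \<le> 1"
proof -
  have "(central_coeff n)\<^sup>2 * 1 \<le> (central_coeff n)\<^sup>2 * (2 * real n + 1)"
    by (intro mult_left_mono) auto
  hence "(central_coeff n)\<^sup>2 \<le> 1"
    using central_coeff_bound[of n] by simp
  thus ?thesis
    using abs_square_le_1[of "central_coeff n"] by simp
qed

text \<open>
  Convergence at the radius itself, with terms of order \<open>m^(-3/2)\<close>, is what makes \<open>a = 1\<close>
  (where \<open>w/(1 + w)\<^sup>2 = 1/4\<close>) accessible.
\<close>

lemma summable_moment_coeff: "summable (\<lambda>m. moment_coeff m * (1/4) ^ m)"
proof (rule summable_comparison_test')
  show "summable (\<lambda>m. real (Suc m) powr (-3/2))"
    by (subst summable_Suc_iff) (simp add: summable_real_powr_iff)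
  fix m :: nat
  have *: "central_coeff k \<le> real (Suc m) powr (-1/2)" if "2 * k \<ge> m" for k
  proof -
    have "(central_coeff k)\<^sup>2 * (real (Suc m)) \<le> (central_coeff k)\<^sup>2 * (2 * real k + 1)"
      using that by (intro mult_left_mono) auto
    also have "\<dots> \<le> 1" by (rule central_coeff_bound)
    finally have "(central_coeff k)\<^sup>2 \<le> 1 / real (Suc m)"
      by (simp add: field_simps)
    hence "sqrt ((central_coeff k)\<^sup>2) \<le> sqrt (1 / real (Suc m))"
      by (rule real_sqrt_le_mono)
    also have "sqrt (1 / real (Suc m)) = real (Suc m) powr (-1/2)"
      by (simp add: powr_minus_divide powr_half_sqrt real_sqrt_divide)
    finally show ?thesis
      using central_coeff_pos[of k] by simp
  qed
  have "moment_coeff m * (1/4) ^ m = central_coeff (2 * m) * central_coeff m * central_coeff m"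
    by (simp add: moment_coeff_def power_divide power2_eq_square)
  also have "\<dots> \<le> real (Suc m) powr (-1/2) * real (Suc m) powr (-1/2) * real (Suc m) powr (-1/2)"
    using * by (intro mult_mono mult_nonneg_nonneg less_imp_le[OF central_coeff_pos]) auto
  also have "\<dots> = real (Suc m) powr (-1/2 + -1/2 + -1/2)"
    by (simp only: powr_add)
  also have "-1/2 + -1/2 + -1/2 = (-3/2 :: real)"
    by simp
  finally show "norm (moment_coeff m * (1/4) ^ m) \<le> real (Suc m) powr (-3/2)"
    using central_coeff_pos[of m] central_coeff_pos[of "2 * m"] by (simp add: moment_coeff_def)
qed

section \<open>Analytic continuation to the segment and passage to its end point\<close>

lemma K_fps_radius: "fps_conv_radius K_fps \<ge> 1"
  unfolding fps_conv_radius_def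
proof (rule conv_radius_geI_ex)
  fix r :: real assume r: "0 < r" "ereal r < 1"
  have "summable (\<lambda>n. fps_nth K_fps n * of_real r ^ n)"
  proof (rule summable_comparison_test')
    show "summable (\<lambda>n. r ^ n)" using r by simp
    fix n
    have "\<bar>central_coeff n\<bar> \<le> 1"
      using central_coeff_le_1[of n] central_coeff_pos[of n] by simp
    hence "(central_coeff n)\<^sup>2 \<le> 1" by (simp add: abs_square_le_1)
    hence "(central_coeff n)\<^sup>2 * r ^ n \<le> 1 * r ^ n"
      using r by (intro mult_right_mono) auto
    thus "norm (fps_nth K_fps n * of_real r ^ n) \<le> r ^ n"
      using r by (simp add: K_fps_def norm_mult norm_power)
  qed
  thus "\<exists>z. norm z = r \<and> summable (\<lambda>n. fps_nth K_fps n * z ^ n)"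
    using r by (intro exI[of _ "of_real r"]) auto
qed

lemma moment_fps_radius: "fps_conv_radius moment_fps \<ge> ereal (1/4)"
proof -
  have "summable (\<lambda>m. complex_of_real (moment_coeff m * (1/4) ^ m))"
    using summable_moment_coeff by (subst summable_of_real_iff)
  hence "summable (\<lambda>m. fps_nth moment_fps m * of_real (1/4) ^ m)"
    by (simp add: moment_fps_def)
  from conv_radius_geI[OF this] show ?thesis
    by (simp add: fps_conv_radius_def)
qed

text \<open>
  The formal identities composed with \<open>w = 4z(z - 1)\<close>. Under this substitution
  \<open>1 + w = (1 - 2z)\<^sup>2\<close>, which replaces the complex powers of \<open>1 + w\<close> by rational functions of \<open>z\<close>.
\<close>

lemma moment_identity_near_0:
  "eventually (\<lambda>z. eval_fps moment_fps (4 * z * (z - 1) / (1 - 2 * z) ^ 4) / (1 - 2 * z) =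
                   (eval_fps K_fps z)\<^sup>2) (nhds 0)"
proof -
  define p :: "complex \<Rightarrow> complex" where "p = (\<lambda>z. 4 * z * (z - 1))"
  define L :: "complex \<Rightarrow> complex"
    where "L = (\<lambda>w. (1 + w) powr (-1/2) * (eval_fps moment_fps \<circ> (\<lambda>w. w * (1 + w) powr (-2))) w)"
  have m: "eval_fps moment_fps has_fps_expansion moment_fps"
  proof (rule eval_fps_has_fps_expansion)
    have "0 < ereal (1/4)" by simp
    thus "0 < fps_conv_radius moment_fps" using moment_fps_radius by (rule less_le_trans)
  qed
  have p: "p has_fps_expansion (fps_const 4 * fps_X * (fps_X - 1))"
    unfolding p_def by (intro fps_expansion_intros)
  have "L has_fps_expansion quarter_fps\<^sup>2"
    unfolding L_def moment_fps_compose [symmetric]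
    by (intro fps_expansion_intros m) auto
  hence "(L \<circ> p) has_fps_expansion (quarter_fps\<^sup>2 oo (fps_const 4 * fps_X * (fps_X - 1)))"
    by (rule has_fps_expansion_compose[OF _ p]) simp
  also have "quarter_fps\<^sup>2 oo (fps_const 4 * fps_X * (fps_X - 1)) = K_fps\<^sup>2"
    by (subst fps_compose_power [symmetric]) (simp_all add: quarter_fps_compose)
  finally have 1: "eventually (\<lambda>z. eval_fps (K_fps\<^sup>2) z = L (p z)) (nhds 0)"
    by (simp add: has_fps_expansion_def)
  have "eval_fps K_fps has_fps_expansion K_fps"
    by (rule eval_fps_has_fps_expansion) (rule less_le_trans[OF _ K_fps_radius], simp)
  hence "(\<lambda>z. eval_fps K_fps z * eval_fps K_fps z) has_fps_expansion K_fps * K_fps"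
    by (intro fps_expansion_intros)
  hence 2: "eventually (\<lambda>z. eval_fps (K_fps\<^sup>2) z = (eval_fps K_fps z)\<^sup>2) (nhds 0)"
    by (simp add: has_fps_expansion_def power2_eq_square)
  have 3: "eventually (\<lambda>z::complex. z \<in> ball 0 (1/2)) (nhds 0)"
    by (intro eventually_nhds_in_open) auto
  show ?thesis
    using 1 2 3
  proof eventually_elim
    case (elim z)
    have "Re z < 1/2"
      using elim(3) complex_Re_le_cmod[of z] by simp
    hence Re: "Re (1 - 2 * z) > 0" by simp
    hence nz: "1 - 2 * z \<noteq> 0" by force
    have sq: "1 + p z = (1 - 2 * z)\<^sup>2"
      by (simp add: p_def power2_eq_square algebra_simps)
    have "(1 + p z) powr (-1/2) = 1 / csqrt ((1 - 2 * z)\<^sup>2)"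
      using nz by (simp add: sq powr_minus_divide csqrt_conv_powr)
    also have "csqrt ((1 - 2 * z)\<^sup>2) = 1 - 2 * z"
      using Re by (intro csqrt_square) auto
    finally have a: "(1 + p z) powr (-1/2) = 1 / (1 - 2 * z)" .
    have b: "(1 + p z) powr (-2) = 1 / (1 - 2 * z) ^ 4"
      using nz by (simp add: sq powr_minus_divide powr_numeral power_mult [symmetric])
    have "L (p z) = eval_fps moment_fps (4 * z * (z - 1) / (1 - 2 * z) ^ 4) / (1 - 2 * z)"
      unfolding L_def o_def a b by (simp add: p_def)
    with elim show ?case by simp
  qed
qed

text \<open>
  Both sides are holomorphic on the open set \<open>V\<close>, on which the two series converge. The segment from
  \<open>x\<close> to \<open>0\<close> lies in \<open>V\<close>, hence in the connected component of \<open>0\<close>, and there the identity theorem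
  applies.
\<close>

lemma moment_identity_real:
  fixes x :: real
  assumes x: "(1 - sqrt 2) / 2 < x" "x \<le> 0"
  shows "eval_fps moment_fps (4 * of_real x * (of_real x - 1) / (1 - 2 * of_real x) ^ 4) / (1 - 2 * of_real x) =
         (eval_fps K_fps (of_real x))\<^sup>2"
proof -
  define V :: "complex set"
    where "V = {z. norm z < 1 \<and> z \<noteq> 1/2 \<and> norm (4 * z * (z - 1) / (1 - 2 * z) ^ 4) < 1/4}"
  define f where "f = (\<lambda>z. eval_fps moment_fps (4 * z * (z - 1) / (1 - 2 * z) ^ 4) / (1 - 2 * z) -
                   (eval_fps K_fps z)\<^sup>2)"
  have "open V"
  proof -
    have "open {z::complex. norm z < 1 \<and> z \<noteq> 1/2}"
      by (intro open_Collect_conj open_Collect_less open_Collect_neq continuous_intros)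
    moreover have "continuous_on {z::complex. norm z < 1 \<and> z \<noteq> 1/2} (\<lambda>z. norm (4 * z * (z - 1) / (1 - 2 * z) ^ 4))"
      by (intro continuous_intros) (auto simp: field_simps)
    ultimately have "open ((\<lambda>z. norm (4 * z * (z - 1) / (1 - 2 * z) ^ 4)) -` {..<1/4} \<inter> {z::complex. norm z < 1 \<and> z \<noteq> 1/2})"
      by (subst (asm) continuous_on_open_vimage) auto
    also have "\<dots> = V" by (auto simp: V_def)
    finally show ?thesis .
  qed
  have hol: "f holomorphic_on V"
  proof -
    have nz: "1 - 2 * z \<noteq> 0" if "z \<in> V" for z
      using that by (auto simp: V_def field_simps)
    have "V \<subseteq> eball 0 (fps_conv_radius K_fps)"
      using less_le_trans[OF _ K_fps_radius] by (auto simp: V_def)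
    hence 1: "eval_fps K_fps holomorphic_on V"
      by (rule holomorphic_on_eval_fps)
    have 2: "(\<lambda>z. 4 * z * (z - 1) / (1 - 2 * z) ^ 4) holomorphic_on V"
      using nz by (intro holomorphic_intros) auto
    have 3: "(\<lambda>z. 4 * z * (z - 1) / (1 - 2 * z) ^ 4) ` V \<subseteq> eball 0 (fps_conv_radius moment_fps)"
    proof
      fix y assume "y \<in> (\<lambda>z. 4 * z * (z - 1) / (1 - 2 * z) ^ 4) ` V"
      hence "ereal (norm y) < ereal (1/4)" by (auto simp: V_def)
      hence "ereal (norm y) < fps_conv_radius moment_fps"
        using moment_fps_radius by (rule less_le_trans)
      thus "y \<in> eball 0 (fps_conv_radius moment_fps)" by simp
    qed
    have "eval_fps moment_fps holomorphic_on eball 0 (fps_conv_radius moment_fps)"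
      by (rule holomorphic_on_eval_fps) simp
    from holomorphic_on_compose_gen[OF 2 this 3]
    have "(\<lambda>z. eval_fps moment_fps (4 * z * (z - 1) / (1 - 2 * z) ^ 4)) holomorphic_on V"
      by (simp add: o_def)
    thus ?thesis
      unfolding f_def using 1 nz
      by (intro holomorphic_on_diff holomorphic_on_divide holomorphic_on_power) (auto intro!: holomorphic_intros)
  qed
  have seg: "closed_segment (of_real x) 0 \<subseteq> V"
  proof
    fix z :: complex assume "z \<in> closed_segment (of_real x) 0"
    then obtain u where u: "0 \<le> u" "u \<le> 1" "z = (1 - u) *\<^sub>R of_real x"
      by (auto simp: in_segment)
    define y where "y = (1 - u) * x"
    have y: "(1 - sqrt 2) / 2 < y" "y \<le> 0"
    proof -
      have "x * 1 \<le> x * (1 - u)" using u x by (intro mult_left_mono_neg) auto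
      hence "x \<le> y" by (simp only: y_def mult.commute mult_1_right)
      thus "(1 - sqrt 2) / 2 < y" using x by linarith
      show "y \<le> 0" using x u by (auto simp: y_def intro!: mult_nonneg_nonpos)
    qed
    have z: "z = of_real y" by (simp add: u(3) y_def scaleR_conv_of_real)
    \<comment> \<open>Here \<open>s = 1 + w\<close>, and the bound \<open>4 (s - 1) < s\<^sup>2\<close> is \<open>(2 - s)\<^sup>2 > 0\<close>, that is \<open>w \<noteq> 1\<close>.\<close>
    define s where "s = (1 - 2 * y)\<^sup>2"
    have "1 - 2 * y < sqrt 2" using y by simp
    moreover have "1 - 2 * y \<ge> 1" using y by simp
    ultimately have s: "s < 2" "s \<ge> 1"
      using power_strict_mono[of "1 - 2 * y" "sqrt 2" 2] by (auto simp: s_def)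
    have "4 * y * (y - 1) = s - 1"
      by (simp add: s_def power2_eq_square algebra_simps)
    moreover have "(1 - 2 * y) ^ 4 = s\<^sup>2"
      by (simp add: s_def power_mult [symmetric])
    ultimately have "4 * y * (y - 1) / (1 - 2 * y) ^ 4 = (s - 1) / s\<^sup>2"
      by (simp only:)
    moreover have "(s - 1) / s\<^sup>2 < 1/4"
    proof -
      have "0 < (2 - s)\<^sup>2" using s by simp
      hence "4 * (s - 1) < s\<^sup>2" by (simp add: power2_eq_square algebra_simps)
      thus ?thesis using s by (simp add: field_simps)
    qed
    moreover have "(s - 1) / s\<^sup>2 \<ge> 0" using s by simp
    ultimately have "norm (4 * y * (y - 1) / (1 - 2 * y) ^ 4) < 1/4"
      by (simp only: real_norm_def abs_of_nonneg)
    moreover have "4 * z * (z - 1) / (1 - 2 * z) ^ 4 = of_real (4 * y * (y - 1) / (1 - 2 * y) ^ 4)"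
      by (simp add: z)
    ultimately have "norm (4 * z * (z - 1) / (1 - 2 * z) ^ 4) < 1/4"
      by (simp only: norm_of_real real_norm_def)
    moreover have "sqrt 2 < 2" using real_sqrt_less_mono[of 2 4] by simp
    hence "norm z < 1" using y unfolding z norm_of_real by (simp add: abs_if field_simps)
    moreover have "z \<noteq> 1/2"
      using y by (auto simp: z complex_eq_iff)
    ultimately show "z \<in> V"
      by (simp add: V_def)
  qed
  define S where "S = connected_component_set V 0"
  have S: "open S" "connected S" "S \<subseteq> V"
    using \<open>open V\<close> by (auto simp: S_def open_connected_component connected_component_subset)
  have segS: "closed_segment (of_real x) 0 \<subseteq> S"
    unfolding S_def using seg by (intro connected_component_maximal) auto
  obtain U where U: "open U" "0 \<in> U" "\<And>z. z \<in> U \<Longrightarrow> f z = 0"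
    using moment_identity_near_0 unfolding eventually_nhds f_def by auto
  have "f (of_real x) = 0"
  proof (rule analytic_continuation[of f S "S \<inter> U" 0])
    show "f holomorphic_on S" using hol S(3) by (rule holomorphic_on_subset)
    show "0 \<in> S" "of_real x \<in> S" using segS by auto
    thus "0 islimpt (S \<inter> U)"
      using S U by (intro interior_limit_point) (auto simp: interior_open open_Int)
  qed (use S U in auto)
  thus ?thesis by (simp add: f_def)
qed

lemma moment_series_eq_square_less_1:
  fixes w :: real
  assumes w: "0 \<le> w" "w < 1"
  shows "(\<Sum>m. moment_coeff m * (w / (1 + w)\<^sup>2) ^ m) / sqrt (1 + w) =
         (\<Sum>n. (central_coeff n)\<^sup>2 * ((1 - sqrt (1 + w)) / 2) ^ n)\<^sup>2"
proof -
  define x where "x = (1 - sqrt (1 + w)) / 2"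
  have sq: "(sqrt (1 + w))\<^sup>2 = 1 + w" using w by simp
  have x2: "1 - 2 * x = sqrt (1 + w)" by (simp add: x_def field_simps)
  have "sqrt (1 + w) < sqrt 2" using w by simp
  hence x: "(1 - sqrt 2) / 2 < x" "x \<le> 0" using w by (auto simp: x_def)
  have x1: "\<bar>x\<bar> < 1"
  proof -
    have "sqrt 2 < 2" using real_sqrt_less_mono[of 2 4] by simp
    thus ?thesis using x by (simp add: abs_if field_simps)
  qed
  have "4 * x * (x - 1) / (1 - 2 * x) ^ 4 = w / (1 + w)\<^sup>2"
  proof -
    have 1: "4 * x * (x - 1) = (1 - 2 * x)\<^sup>2 - 1" by (simp add: power2_eq_square algebra_simps)
    have 2: "(1 - 2 * x) ^ 4 = ((1 - 2 * x)\<^sup>2)\<^sup>2" by (simp add: power_mult [symmetric])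
    show ?thesis unfolding 1 2 unfolding x2 sq by simp
  qed
  have "4 * of_real x * (of_real x - 1) / (1 - 2 * of_real x) ^ 4 =
          complex_of_real (4 * x * (x - 1) / (1 - 2 * x) ^ 4)"
    by simp
  also note \<open>4 * x * (x - 1) / (1 - 2 * x) ^ 4 = w / (1 + w)\<^sup>2\<close>
  finally have arg: "4 * of_real x * (of_real x - 1) / (1 - 2 * of_real x) ^ 4 = complex_of_real (w / (1 + w)\<^sup>2)" .
  have s: "\<bar>w / (1 + w)\<^sup>2\<bar> < 1/4"
  proof -
    have "0 < (1 - w)\<^sup>2" using w by simp
    hence "4 * w < (1 + w)\<^sup>2" by (simp add: power2_eq_square algebra_simps)
    thus ?thesis using w by (simp add: field_simps)
  qed
  have real_sums: "(\<lambda>n. c n * t ^ n) sums Re (eval_fps (Abs_fps (\<lambda>n. complex_of_real (c n))) (of_real t))"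
    and real_val: "eval_fps (Abs_fps (\<lambda>n. complex_of_real (c n))) (of_real t) =
       of_real (Re (eval_fps (Abs_fps (\<lambda>n. complex_of_real (c n))) (of_real t)))"
    if "ereal \<bar>t\<bar> < fps_conv_radius (Abs_fps (\<lambda>n. complex_of_real (c n)))" for c t
  proof -
    have *: "(\<lambda>n. complex_of_real (c n * t ^ n)) sums eval_fps (Abs_fps (\<lambda>n. complex_of_real (c n))) (of_real t)"
      using sums_eval_fps[of "of_real t" "Abs_fps (\<lambda>n. complex_of_real (c n))"] that by simp
    from sums_Re[OF *] show 1: "(\<lambda>n. c n * t ^ n) sums Re (eval_fps (Abs_fps (\<lambda>n. complex_of_real (c n))) (of_real t))"
      by simp
    from sums_of_real[OF 1] * show "eval_fps (Abs_fps (\<lambda>n. complex_of_real (c n))) (of_real t) =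
       of_real (Re (eval_fps (Abs_fps (\<lambda>n. complex_of_real (c n))) (of_real t)))"
      using sums_unique2 by blast
  qed
  have r1: "ereal \<bar>w / (1 + w)\<^sup>2\<bar> < fps_conv_radius moment_fps"
    using s by (intro less_le_trans[OF _ moment_fps_radius]) simp
  have r2: "ereal \<bar>x\<bar> < fps_conv_radius K_fps"
    using x1 by (intro less_le_trans[OF _ K_fps_radius]) simp
  have v1: "eval_fps moment_fps (of_real (w / (1 + w)\<^sup>2)) = of_real (\<Sum>m. moment_coeff m * (w / (1 + w)\<^sup>2) ^ m)"
    using real_sums[OF r1[unfolded moment_fps_def]] real_val[OF r1[unfolded moment_fps_def]]
    by (simp add: sums_iff moment_fps_def)
  have v2: "eval_fps K_fps (of_real x) = of_real (\<Sum>n. (central_coeff n)\<^sup>2 * x ^ n)"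
    using real_sums[OF r2[unfolded K_fps_def]] real_val[OF r2[unfolded K_fps_def]]
    by (simp add: sums_iff K_fps_def)
  have "1 - 2 * complex_of_real x = of_real (sqrt (1 + w))"
    by (simp add: x2 [symmetric])
  with moment_identity_real[OF x]
  have "complex_of_real ((\<Sum>m. moment_coeff m * (w / (1 + w)\<^sup>2) ^ m) / sqrt (1 + w)) =
        of_real ((\<Sum>n. (central_coeff n)\<^sup>2 * x ^ n)\<^sup>2)"
    unfolding arg v1 v2 by (simp only: of_real_divide of_real_power)
  thus ?thesis
    unfolding of_real_eq_iff x_def .
qed

lemma moment_coeff_nonneg: "moment_coeff m \<ge> 0"
  using central_coeff_pos[of m] central_coeff_pos[of "2 * m"] by (simp add: moment_coeff_def)

lemma quotient_le_quarter:
  fixes w :: real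
  assumes "w \<ge> 0"
  shows "w / (1 + w)\<^sup>2 \<le> 1/4"
proof -
  have "0 \<le> (1 - w)\<^sup>2" by simp
  hence "4 * w \<le> (1 + w)\<^sup>2" by (simp add: power2_eq_square algebra_simps)
  thus ?thesis using assms by (simp add: field_simps)
qed

lemma moment_series_bound:
  assumes "w \<ge> 0"
  shows "norm (moment_coeff m * (w / (1 + w)\<^sup>2) ^ m) \<le> moment_coeff m * (1/4) ^ m"
proof -
  have "moment_coeff m * (w / (1 + w)\<^sup>2) ^ m \<le> moment_coeff m * (1/4) ^ m"
    using assms quotient_le_quarter[OF assms] by (intro mult_left_mono power_mono moment_coeff_nonneg) auto
  thus ?thesis using assms by (simp add: moment_coeff_nonneg)
qed

text \<open>
  The case \<open>w = 1\<close> lies on the boundary of the domain of analytic continuation; it follows because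
  both series converge uniformly on \<open>{0..1}\<close>.
\<close>

lemma moment_series_eq_square:
  fixes w :: real
  assumes w: "0 \<le> w" "w \<le> 1"
  shows "(\<Sum>m. moment_coeff m * (w / (1 + w)\<^sup>2) ^ m) / sqrt (1 + w) =
         (\<Sum>n. (central_coeff n)\<^sup>2 * ((1 - sqrt (1 + w)) / 2) ^ n)\<^sup>2"
proof -
  have pos: "1 + w \<noteq> 0" if "w \<in> {0..1}" for w :: real using that by auto
  have f: "continuous_on {0..1} (\<lambda>w::real. \<Sum>m. moment_coeff m * (w / (1 + w)\<^sup>2) ^ m)"
  proof (rule uniform_limit_theorem)
    show "uniform_limit {0..1} (\<lambda>N w. \<Sum>m<N. moment_coeff m * (w / (1 + w)\<^sup>2) ^ m)
            (\<lambda>w::real. \<Sum>m. moment_coeff m * (w / (1 + w)\<^sup>2) ^ m) sequentially"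
      by (rule Weierstrass_m_test[OF moment_series_bound summable_moment_coeff]) auto
    show "\<forall>\<^sub>F N in sequentially. continuous_on {0..1} (\<lambda>w::real. \<Sum>m<N. moment_coeff m * (w / (1 + w)\<^sup>2) ^ m)"
      using pos by (intro always_eventually allI continuous_intros) auto
  qed auto
  have g: "continuous_on {0..1} (\<lambda>w::real. \<Sum>n. (central_coeff n)\<^sup>2 * ((1 - sqrt (1 + w)) / 2) ^ n)"
  proof (rule uniform_limit_theorem)
    show "uniform_limit {0..1} (\<lambda>N w. \<Sum>n<N. (central_coeff n)\<^sup>2 * ((1 - sqrt (1 + w)) / 2) ^ n)
            (\<lambda>w::real. \<Sum>n. (central_coeff n)\<^sup>2 * ((1 - sqrt (1 + w)) / 2) ^ n) sequentially"
    proof (rule Weierstrass_m_test)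
      show "summable (\<lambda>n. (1/2 :: real) ^ n)" by simp
      fix n and w :: real assume w: "w \<in> {0..1}"
      have "sqrt (1 + w) \<ge> 1" using w by simp
      moreover have "sqrt (1 + w) \<le> sqrt 4" using w by (intro real_sqrt_le_mono) auto
      ultimately have x: "\<bar>(1 - sqrt (1 + w)) / 2\<bar> \<le> 1/2" by simp
      have "\<bar>central_coeff n\<bar> \<le> 1"
        using central_coeff_le_1[of n] central_coeff_pos[of n] by simp
      hence "(central_coeff n)\<^sup>2 \<le> 1" by (simp add: abs_square_le_1)
      hence "(central_coeff n)\<^sup>2 * \<bar>(1 - sqrt (1 + w)) / 2\<bar> ^ n \<le> 1 * (1/2) ^ n"
        using x by (intro mult_mono power_mono) auto
      thus "norm ((central_coeff n)\<^sup>2 * ((1 - sqrt (1 + w)) / 2) ^ n) \<le> (1/2) ^ n"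
        by (simp add: abs_mult power_abs)
    qed
    show "\<forall>\<^sub>F N in sequentially. continuous_on {0..1} (\<lambda>w::real. \<Sum>n<N. (central_coeff n)\<^sup>2 * ((1 - sqrt (1 + w)) / 2) ^ n)"
      by (intro always_eventually allI continuous_intros) auto
  qed auto
  define h where "h = (\<lambda>w::real. (\<Sum>m. moment_coeff m * (w / (1 + w)\<^sup>2) ^ m) / sqrt (1 + w) -
         (\<Sum>n. (central_coeff n)\<^sup>2 * ((1 - sqrt (1 + w)) / 2) ^ n)\<^sup>2)"
  have closure: "closure {0..<1} = {0..1::real}" by simp
  have "h w = 0"
  proof (rule continuous_constant_on_closure[of "{0..<1}" h])
    show "continuous_on (closure {0..<1}) h"
      unfolding closure h_def
    proof (intro continuous_on_diff continuous_on_divide continuous_on_power f g)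
      show "continuous_on {0..1} (\<lambda>w::real. sqrt (1 + w))"
        by (intro continuous_intros)
    qed auto
    show "h w = 0" if "w \<in> {0..<1}" for w
      using moment_series_eq_square_less_1[of w] that unfolding h_def by (simp only: atLeastLessThan_iff diff_self)
    show "w \<in> closure {0..<1}"
      unfolding closure using w by simp
  qed
  thus ?thesis unfolding h_def by (simp only: right_minus_eq)
qed

section \<open>The complete elliptic integral as a power series\<close>

text \<open>
  Wallis' integral, by differentiating \<open>- cos \<theta> * sin \<theta> ^ (2n + 1)\<close>.
\<close>

lemma has_integral_sin_power:
  "((\<lambda>\<theta>. sin \<theta> ^ (2 * n)) has_integral (pi / 2 * central_coeff n)) {0..pi/2}"
proof (induction n)
  case 0
  show ?case using has_integral_const_real[of "1 :: real" 0 "pi/2"] by simp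
next
  case (Suc n)
  have "((\<lambda>\<theta>. (2 * real n + 2) * sin \<theta> ^ (2 * Suc n) - (2 * real n + 1) * sin \<theta> ^ (2 * n)) has_integral
          (- cos (pi/2) * sin (pi/2) ^ (2 * n + 1) - (- cos 0 * sin 0 ^ (2 * n + 1)))) {0..pi/2}"
  proof (rule fundamental_theorem_of_calculus)
    fix \<theta> :: real
    have "((\<lambda>\<theta>. - cos \<theta> * sin \<theta> ^ (2 * n + 1)) has_real_derivative
            sin \<theta> * sin \<theta> ^ (2 * n + 1) - cos \<theta> * ((2 * real n + 1) * sin \<theta> ^ (2 * n) * cos \<theta>)) (at \<theta> within {0..pi/2})"
    proof -
      have "((\<lambda>\<theta>. sin \<theta> ^ (2 * n + 1)) has_real_derivative (2 * real n + 1) * sin \<theta> ^ (2 * n) * cos \<theta>)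
              (at \<theta> within {0..pi/2})"
        using DERIV_power[OF DERIV_subset[OF DERIV_sin subset_UNIV], of "2 * n + 1" \<theta> "{0..pi/2}"]
        by (simp add: mult_ac add_ac)
      moreover have "((\<lambda>\<theta>. - cos \<theta>) has_real_derivative sin \<theta>) (at \<theta> within {0..pi/2})"
        by (auto intro!: derivative_eq_intros)
      ultimately show ?thesis
        by - (rule DERIV_cong [OF DERIV_mult], assumption, assumption, simp add: mult_ac)
    qed
    moreover have "sin \<theta> * sin \<theta> ^ (2 * n + 1) - cos \<theta> * ((2 * real n + 1) * sin \<theta> ^ (2 * n) * cos \<theta>) =
          (2 * real n + 2) * sin \<theta> ^ (2 * Suc n) - (2 * real n + 1) * sin \<theta> ^ (2 * n)"
    proof -
      have 1: "sin \<theta> * sin \<theta> ^ (2 * n + 1) = (sin \<theta>)\<^sup>2 * sin \<theta> ^ (2 * n)"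
        by (simp add: power2_eq_square)
      have 2: "sin \<theta> ^ (2 * Suc n) = (sin \<theta>)\<^sup>2 * sin \<theta> ^ (2 * n)"
        by (simp add: power2_eq_square)
      have 3: "cos \<theta> * ((2 * real n + 1) * sin \<theta> ^ (2 * n) * cos \<theta>) =
            (2 * real n + 1) * sin \<theta> ^ (2 * n) * (1 - (sin \<theta>)\<^sup>2)"
        unfolding cos_squared_eq [symmetric] by (simp add: power2_eq_square mult_ac)
      show ?thesis
        unfolding 1 2 3 by (simp only: ring_distribs) simp
    qed
    ultimately show "((\<lambda>\<theta>. - cos \<theta> * sin \<theta> ^ (2 * n + 1)) has_vector_derivative
          ((2 * real n + 2) * sin \<theta> ^ (2 * Suc n) - (2 * real n + 1) * sin \<theta> ^ (2 * n))) (at \<theta> within {0..pi/2})"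
      by (simp only: has_real_derivative_iff_has_vector_derivative)
  qed simp
  hence "((\<lambda>\<theta>. (2 * real n + 2) * sin \<theta> ^ (2 * Suc n) - (2 * real n + 1) * sin \<theta> ^ (2 * n)) has_integral 0) {0..pi/2}"
    by simp
  from has_integral_add[OF this has_integral_mult_right[OF Suc, of "2 * real n + 1"]]
  have "((\<lambda>\<theta>. (2 * real n + 2) * sin \<theta> ^ (2 * Suc n)) has_integral ((2 * real n + 1) * (pi / 2 * central_coeff n))) {0..pi/2}"
    by simp
  from has_integral_mult_right[OF this, of "1 / (2 * real n + 2)"]
  have "((\<lambda>\<theta>. sin \<theta> ^ (2 * Suc n)) has_integral
          (1 / (2 * real n + 2) * ((2 * real n + 1) * (pi / 2 * central_coeff n)))) {0..pi/2}"
    by (simp only: mult.assoc [symmetric]) (simp del: power_Suc)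
  also have "1 / (2 * real n + 2) * ((2 * real n + 1) * (pi / 2 * central_coeff n)) = pi / 2 * central_coeff (Suc n)"
    by (simp add: central_coeff_Suc field_simps)
  finally show ?case .
qed

lemma central_coeff_sums:
  fixes x :: real
  assumes "\<bar>x\<bar> < 1"
  shows "(\<lambda>n. central_coeff n * x ^ n) sums (1 / sqrt (1 - x))"
proof -
  have "(\<lambda>n. ((-1/2) gchoose n) * (-x) ^ n) sums (1 + (-x)) powr (-1/2)"
    using assms by (intro gen_binomial_real) auto
  moreover have "((-1/2) gchoose n) * (-x) ^ n = central_coeff n * x ^ n" for n
    by (simp add: gbinomial_pochhammer central_coeff_def power_mult_distrib [symmetric])
  moreover have "(1 + (-x)) powr (-1/2) = 1 / sqrt (1 - x)"
    using assms by (simp add: powr_minus_divide powr_half_sqrt)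
  ultimately show ?thesis by simp
qed

lemma ellipticK_eq_of_real:
  fixes m :: real
  assumes k: "k\<^sup>2 = complex_of_real m" and m: "m < 1"
  shows "((\<lambda>\<theta>. 1 / sqrt (1 - m * (sin \<theta>)\<^sup>2)) has_integral Re (ellipticK k)) {0..pi/2}"
    and "ellipticK k = of_real (Re (ellipticK k))"
proof -
  have pos: "1 - m * (sin \<theta>)\<^sup>2 > 0" for \<theta> :: real
  proof (cases "m \<le> 0")
    case True
    hence "m * (sin \<theta>)\<^sup>2 \<le> 0" by (simp add: mult_le_0_iff)
    thus ?thesis by simp
  next
    case False
    hence "m * (sin \<theta>)\<^sup>2 \<le> m * 1" by (intro mult_left_mono) (auto simp: abs_square_le_1)
    thus ?thesis using m by simp
  qed
  have "continuous_on {0..pi/2} (\<lambda>\<theta>. 1 / sqrt (1 - m * (sin \<theta>)\<^sup>2))"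
    using pos by (intro continuous_intros) (auto simp: less_le)
  hence "(\<lambda>\<theta>. 1 / sqrt (1 - m * (sin \<theta>)\<^sup>2)) integrable_on {0..pi/2}"
    by (rule integrable_continuous_real)
  then obtain I where I: "((\<lambda>\<theta>. 1 / sqrt (1 - m * (sin \<theta>)\<^sup>2)) has_integral I) {0..pi/2}"
    by (auto simp: integrable_on_def)
  have "1 / csqrt (1 - k\<^sup>2 * (complex_of_real (sin \<theta>))\<^sup>2) = of_real (1 / sqrt (1 - m * (sin \<theta>)\<^sup>2))" for \<theta>
  proof -
    have "1 - k\<^sup>2 * (complex_of_real (sin \<theta>))\<^sup>2 = of_real (1 - m * (sin \<theta>)\<^sup>2)"
      by (simp add: k)
    thus ?thesis
      using pos[of \<theta>] by (simp only: of_real_sqrt [symmetric] less_imp_le of_real_divide of_real_1)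
  qed
  hence "ellipticK k = integral {0..pi/2} (\<lambda>\<theta>. complex_of_real (1 / sqrt (1 - m * (sin \<theta>)\<^sup>2)))"
    unfolding ellipticK_def by simp
  also have "\<dots> = of_real I"
    by (rule integral_unique) (rule has_integral_of_real[OF I])
  finally have *: "ellipticK k = of_real I" .
  show "((\<lambda>\<theta>. 1 / sqrt (1 - m * (sin \<theta>)\<^sup>2)) has_integral Re (ellipticK k)) {0..pi/2}"
    "ellipticK k = of_real (Re (ellipticK k))"
    using I by (simp_all add: *)
qed

lemma ellipticK_series:
  fixes m :: real
  assumes k: "k\<^sup>2 = complex_of_real m" and m: "\<bar>m\<bar> < 1"
  shows "ellipticK k = of_real (pi / 2 * (\<Sum>n. (central_coeff n)\<^sup>2 * m ^ n))"
proof -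
  let ?f = "\<lambda>n \<theta>. central_coeff n * (m * (sin \<theta>)\<^sup>2) ^ n"
  have le: "\<bar>m * (sin \<theta>)\<^sup>2\<bar> \<le> \<bar>m\<bar>" for \<theta>
    unfolding abs_mult by (rule mult_left_le) (auto simp: abs_square_le_1)
  have unif: "uniform_limit {0..pi/2} (\<lambda>N \<theta>. \<Sum>n<N. ?f n \<theta>) (\<lambda>\<theta>. \<Sum>n. ?f n \<theta>) sequentially"
  proof (rule Weierstrass_m_test)
    show "summable (\<lambda>n. \<bar>m\<bar> ^ n)" using m by simp
    fix n \<theta>
    have "norm (?f n \<theta>) = central_coeff n * \<bar>m * (sin \<theta>)\<^sup>2\<bar> ^ n"
      using central_coeff_pos[of n] by (simp add: abs_mult power_abs)
    also have "\<dots> \<le> 1 * \<bar>m\<bar> ^ n"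
      using central_coeff_pos[of n] le[of \<theta>] by (intro mult_mono power_mono central_coeff_le_1) auto
    finally show "norm (?f n \<theta>) \<le> \<bar>m\<bar> ^ n" by simp
  qed
  have sum_f: "(\<Sum>n. ?f n \<theta>) = 1 / sqrt (1 - m * (sin \<theta>)\<^sup>2)" for \<theta>
    using le[of \<theta>] m by (intro sums_unique [symmetric] central_coeff_sums) linarith
  have int_f: "((\<lambda>\<theta>. \<Sum>n<N. ?f n \<theta>) has_integral (\<Sum>n<N. pi / 2 * ((central_coeff n)\<^sup>2 * m ^ n))) {0..pi/2}" for N
  proof (intro has_integral_sum)
    fix n
    from has_integral_mult_right[OF has_integral_sin_power[of n], of "central_coeff n * m ^ n"]
    show "(?f n has_integral pi / 2 * ((central_coeff n)\<^sup>2 * m ^ n)) {0..pi/2}"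
      by (simp add: power_mult power_mult_distrib power2_eq_square mult_ac)
  qed auto
  obtain I J where IJ: "\<And>N. ((\<lambda>\<theta>. \<Sum>n<N. ?f n \<theta>) has_integral I N) {0..pi/2}"
    "((\<lambda>\<theta>. \<Sum>n. ?f n \<theta>) has_integral J) {0..pi/2}" "I \<longlonglongrightarrow> J"
    by (rule uniform_limit_integral[OF unif]) (auto intro!: continuous_intros)
  have "I = (\<lambda>N. \<Sum>n<N. pi / 2 * ((central_coeff n)\<^sup>2 * m ^ n))"
    using IJ(1) int_f by (intro ext) (rule has_integral_unique)
  hence J: "(\<lambda>n. pi / 2 * ((central_coeff n)\<^sup>2 * m ^ n)) sums J"
    using IJ(3) by (simp only: sums_def)
  from sums_mult[OF this, of "2 / pi"] have "(\<lambda>n. (central_coeff n)\<^sup>2 * m ^ n) sums (2 / pi * J)"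
    by simp
  hence "J = pi / 2 * (\<Sum>n. (central_coeff n)\<^sup>2 * m ^ n)"
    by (simp add: sums_iff)
  moreover have "Re (ellipticK k) = J"
    using ellipticK_eq_of_real(1)[OF k] IJ(2) m
    by (intro has_integral_unique[of _ _ "{0..pi/2}"]) (auto simp: sum_f)
  ultimately have "Re (ellipticK k) = pi / 2 * (\<Sum>n. (central_coeff n)\<^sup>2 * m ^ n)"
    by simp
  moreover have "m < 1" using m by simp
  ultimately show ?thesis
    using ellipticK_eq_of_real(2)[OF k] by metis
qed

section \<open>Moments of the complementary integral\<close>

text \<open>
  The function \<open>K(sqrt(1 - u\<^sup>2))\<close> with values in the extended nonnegative reals: Tonelli's theorem and
  monotone convergence then need no integrability conditions, and at \<open>u = 0\<close>, where the integral
  diverges, the value is infinite.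
\<close>

definition complementary_K :: "real \<Rightarrow> ennreal" where
  "complementary_K u = (\<integral>\<^sup>+\<theta>. ennreal (1 / sqrt (1 - (1 - u\<^sup>2) * (sin \<theta>)\<^sup>2)) * indicator {0..pi/2} \<theta> \<partial>lborel)"

lemma complementary_K_measurable [measurable]: "complementary_K \<in> borel_measurable borel"
  unfolding complementary_K_def by measurable

lemma complementary_K_minus [simp]: "complementary_K (-u) = complementary_K u"
  by (simp add: complementary_K_def)

lemma complementary_K_eq_ellipticK:
  assumes k: "k\<^sup>2 = complex_of_real (1 - u\<^sup>2)" and u: "u \<noteq> 0"
  shows "complementary_K u = ennreal (Re (ellipticK k))" and "Re (ellipticK k) \<ge> 0"
proof -
  have m: "1 - u\<^sup>2 < 1" using u by simp
  have nonneg: "1 - (1 - u\<^sup>2) * (sin \<theta>)\<^sup>2 \<ge> 0" for \<theta> :: real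
  proof -
    have "1 - (1 - u\<^sup>2) * (sin \<theta>)\<^sup>2 = (cos \<theta>)\<^sup>2 + u\<^sup>2 * (sin \<theta>)\<^sup>2"
      by (simp add: cos_squared_eq algebra_simps)
    thus ?thesis by simp
  qed
  note I = ellipticK_eq_of_real(1)[OF k m]
  show "complementary_K u = ennreal (Re (ellipticK k))"
    unfolding complementary_K_def using nonneg by (intro nn_integral_has_integral_lebesgue'[OF _ I]) auto
  show "Re (ellipticK k) \<ge> 0"
    using nonneg by (intro has_integral_nonneg[OF I]) auto
qed

text \<open>
  The substitution \<open>cos \<alpha> = sqrt(1 - u\<^sup>2) * sin \<theta>\<close>. In this form the variables \<open>u\<close> and \<open>\<alpha>\<close> enter the
  integrand only through \<open>u\<close> and \<open>sin \<alpha>\<close>, which is what the interchange of integrals below uses.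
\<close>

lemma complementary_K_as_sine_integral:
  assumes u: "0 < u" "u < 1"
  shows "complementary_K u = (\<integral>\<^sup>+\<alpha>. ennreal (1 / sqrt ((sin \<alpha>)\<^sup>2 - u\<^sup>2)) * indicator {\<alpha>\<in>{0..pi/2}. u \<le> sin \<alpha>} \<alpha> \<partial>lborel)"
proof -
  define b where "b = sqrt (1 - u\<^sup>2)"
  have u2: "0 < u\<^sup>2" "u\<^sup>2 < 1" using u by (auto simp: power_less_one_iff)
  have b: "0 < b" "b < 1" and b2: "b\<^sup>2 = 1 - u\<^sup>2" using u2 by (auto simp: b_def)
  \<comment> \<open>With \<open>cos \<theta>\<close> in place of \<open>sin \<theta>\<close> the substitution is increasing; the reflection
      \<open>\<theta> \<mapsto> \<pi>/2 - \<theta>\<close> undoes the change at the end.\<close>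
  define g where "g = (\<lambda>\<theta>. arccos (b * cos \<theta>))"
  define g' where "g' = (\<lambda>\<theta>. b * sin \<theta> / sqrt (1 - (b * cos \<theta>)\<^sup>2))"
  have bc: "\<bar>b * cos \<theta>\<bar> < 1" for \<theta>
  proof -
    have "\<bar>b * cos \<theta>\<bar> \<le> b * 1"
      unfolding abs_mult using b by (intro mult_mono) auto
    thus ?thesis using b by simp
  qed
  have bc2: "(b * cos \<theta>)\<^sup>2 < 1" for \<theta>
    using bc[of \<theta>] by (simp add: abs_square_less_1)
  have g_ends: "g 0 = arccos b" "g (pi/2) = pi/2"
    by (simp_all add: g_def)
  have dom: "\<alpha> \<in> {g 0..g (pi/2)} \<longleftrightarrow> \<alpha> \<in> {0..pi/2} \<and> u \<le> sin \<alpha>" for \<alpha>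
  proof (cases "\<alpha> \<in> {0..pi/2}")
    case True
    hence nonneg: "cos \<alpha> \<ge> 0" "sin \<alpha> \<ge> 0"
      by (auto intro!: cos_ge_zero sin_ge_zero)
    have "arccos b \<le> \<alpha> \<longleftrightarrow> arccos b \<le> arccos (cos \<alpha>)"
      using True by (subst arccos_cos) auto
    also have "\<dots> \<longleftrightarrow> cos \<alpha> \<le> b"
      using b by (intro arccos_le_mono) (auto simp: abs_if)
    also have "\<dots> \<longleftrightarrow> (cos \<alpha>)\<^sup>2 \<le> b\<^sup>2"
      using b nonneg by (subst power2_le_iff_abs_le) auto
    also have "\<dots> \<longleftrightarrow> u\<^sup>2 \<le> (sin \<alpha>)\<^sup>2"
      by (simp add: b2 cos_squared_eq)
    also have "\<dots> \<longleftrightarrow> u \<le> sin \<alpha>"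
      using u nonneg by (subst power2_le_iff_abs_le) auto
    finally show ?thesis using True by (auto simp: g_ends)
  next
    case False
    have "arccos b \<ge> 0" using b by (intro arccos_lbound) auto
    thus ?thesis using False by (auto simp: g_ends)
  qed
  have "(\<integral>\<^sup>+\<alpha>. ennreal (1 / sqrt ((sin \<alpha>)\<^sup>2 - u\<^sup>2)) * indicator {\<alpha>\<in>{0..pi/2}. u \<le> sin \<alpha>} \<alpha> \<partial>lborel) =
        (\<integral>\<^sup>+\<alpha>. ennreal (1 / sqrt ((sin \<alpha>)\<^sup>2 - u\<^sup>2) * indicator {g 0..g (pi/2)} \<alpha>) \<partial>lborel)"
    by (intro nn_integral_cong) (use dom in \<open>auto simp: indicator_def\<close>)
  also have "\<dots> = (\<integral>\<^sup>+\<theta>. ennreal (1 / sqrt ((sin (g \<theta>))\<^sup>2 - u\<^sup>2) * g' \<theta> * indicator {0..pi/2} \<theta>) \<partial>lborel)"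
  proof (rule nn_integral_substitution)
    show "set_borel_measurable borel {g 0..g (pi/2)} (\<lambda>\<alpha>. 1 / sqrt ((sin \<alpha>)\<^sup>2 - u\<^sup>2))"
      unfolding set_borel_measurable_def by measurable
    show "(g has_real_derivative g' \<theta>) (at \<theta>)" for \<theta>
      unfolding g_def g'_def using bc[of \<theta>]
      by (auto intro!: derivative_eq_intros simp: abs_less_iff divide_inverse)
    have "1 - (b * cos \<theta>)\<^sup>2 \<noteq> 0" for \<theta> using bc2[of \<theta>] by simp
    thus "continuous_on {0..pi/2} g'"
      unfolding g'_def by (intro continuous_intros) auto
    show "g' \<theta> \<ge> 0" if "\<theta> \<in> {0..pi/2}" for \<theta>
      using that b bc2[of \<theta>] by (auto simp: g'_def intro!: divide_nonneg_nonneg mult_nonneg_nonneg sin_ge_zero)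
  qed simp
  also have "\<dots> = (\<integral>\<^sup>+\<theta>. ennreal (1 / sqrt (1 - (b * cos \<theta>)\<^sup>2)) * indicator {0..pi/2} \<theta> \<partial>lborel)"
  proof (rule nn_integral_cong_AE)
    \<comment> \<open>At \<open>\<theta> = 0\<close> the denominator vanishes together with \<open>g' \<theta>\<close>.\<close>
    have "AE \<theta> in lborel. \<theta> \<noteq> (0::real)" by (rule AE_lborel_singleton)
    thus "AE \<theta> in lborel. ennreal (1 / sqrt ((sin (g \<theta>))\<^sup>2 - u\<^sup>2) * g' \<theta> * indicator {0..pi/2} \<theta>) =
             ennreal (1 / sqrt (1 - (b * cos \<theta>)\<^sup>2)) * indicator {0..pi/2} \<theta>"
    proof eventually_elim
      case (elim \<theta>)
      show ?case
      proof (cases "\<theta> \<in> {0..pi/2}")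
        case True
        hence s: "sin \<theta> > 0" using elim by (intro sin_gt_zero) auto
        have "(sin (g \<theta>))\<^sup>2 - u\<^sup>2 = 1 - (b * cos \<theta>)\<^sup>2 - u\<^sup>2"
          unfolding g_def using bc[of \<theta>] by (subst sin_squared_eq) (auto simp: cos_arccos_abs)
        also have "\<dots> = (b * sin \<theta>)\<^sup>2"
          using b2 by (simp add: power_mult_distrib sin_squared_eq algebra_simps)
        finally have "1 / sqrt ((sin (g \<theta>))\<^sup>2 - u\<^sup>2) * g' \<theta> = 1 / sqrt (1 - (b * cos \<theta>)\<^sup>2)"
          using s b by (simp add: g'_def)
        thus ?thesis using True by simp
      qed simp
    qed
  qed
  also have "\<dots> = (\<integral>\<^sup>+\<theta>. ennreal (1 / sqrt (1 - (b * cos (pi/2 + (-1) * \<theta>))\<^sup>2)) * indicator {0..pi/2} (pi/2 + (-1) * \<theta>) \<partial>lborel)"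
    by (subst nn_integral_real_affine[where c = "-1" and t = "pi/2"]) auto
  also have "\<dots> = complementary_K u"
    unfolding complementary_K_def
    by (intro nn_integral_cong) (auto simp: indicator_def power_mult_distrib b2 sin_cos_eq)
  finally show ?thesis by simp
qed

text \<open>
  The substitution \<open>u = sin \<alpha> * sin \<beta>\<close> reduces the integral to Wallis' integral.
\<close>

lemma nn_integral_even_power_over_sqrt:
  assumes \<alpha>: "0 < \<alpha>" "\<alpha> \<le> pi / 2"
  shows "(\<integral>\<^sup>+u. ennreal (u ^ (2 * m) / sqrt ((sin \<alpha>)\<^sup>2 - u\<^sup>2)) * indicator {0..sin \<alpha>} u \<partial>lborel) =
         ennreal (sin \<alpha> ^ (2 * m) * (pi / 2 * central_coeff m))"
proof -
  have s: "sin \<alpha> > 0" using \<alpha> by (intro sin_gt_zero) auto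
  define g where "g = (\<lambda>\<beta>. sin \<alpha> * sin \<beta>)"
  have "(\<integral>\<^sup>+u. ennreal (u ^ (2 * m) / sqrt ((sin \<alpha>)\<^sup>2 - u\<^sup>2)) * indicator {0..sin \<alpha>} u \<partial>lborel) =
        (\<integral>\<^sup>+u. ennreal (u ^ (2 * m) / sqrt ((sin \<alpha>)\<^sup>2 - u\<^sup>2) * indicator {g 0..g (pi/2)} u) \<partial>lborel)"
    by (intro nn_integral_cong) (auto simp: indicator_def g_def)
  also have "\<dots> = (\<integral>\<^sup>+\<beta>. ennreal (g \<beta> ^ (2 * m) / sqrt ((sin \<alpha>)\<^sup>2 - (g \<beta>)\<^sup>2) * (sin \<alpha> * cos \<beta>) * indicator {0..pi/2} \<beta>) \<partial>lborel)"
  proof (rule nn_integral_substitution)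
    show "set_borel_measurable borel {g 0..g (pi/2)} (\<lambda>u. u ^ (2 * m) / sqrt ((sin \<alpha>)\<^sup>2 - u\<^sup>2))"
      unfolding set_borel_measurable_def by measurable
    show "(g has_real_derivative (sin \<alpha> * cos \<beta>)) (at \<beta>)" for \<beta>
      unfolding g_def by (auto intro!: derivative_eq_intros)
    show "continuous_on {0..pi/2} (\<lambda>\<beta>. sin \<alpha> * cos \<beta>)"
      by (intro continuous_intros)
    show "sin \<alpha> * cos \<beta> \<ge> 0" if "\<beta> \<in> {0..pi/2}" for \<beta>
      using that s by (auto intro!: mult_nonneg_nonneg cos_ge_zero)
  qed simp
  also have "\<dots> = (\<integral>\<^sup>+\<beta>. ennreal (sin \<alpha> ^ (2 * m) * sin \<beta> ^ (2 * m)) * indicator {0..pi/2} \<beta> \<partial>lborel)"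
  proof (rule nn_integral_cong_AE)
    have "AE \<beta> in lborel. \<beta> \<noteq> pi/2" by (rule AE_lborel_singleton)
    thus "AE \<beta> in lborel. ennreal (g \<beta> ^ (2 * m) / sqrt ((sin \<alpha>)\<^sup>2 - (g \<beta>)\<^sup>2) * (sin \<alpha> * cos \<beta>) * indicator {0..pi/2} \<beta>) =
             ennreal (sin \<alpha> ^ (2 * m) * sin \<beta> ^ (2 * m)) * indicator {0..pi/2} \<beta>"
    proof eventually_elim
      case (elim \<beta>)
      show ?case
      proof (cases "\<beta> \<in> {0..pi/2}")
        case True
        hence c: "cos \<beta> > 0" using elim by (intro cos_gt_zero_pi) auto
        have "(sin \<alpha>)\<^sup>2 - (g \<beta>)\<^sup>2 = (sin \<alpha> * cos \<beta>)\<^sup>2"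
          by (simp add: g_def power_mult_distrib cos_squared_eq algebra_simps)
        hence "g \<beta> ^ (2 * m) / sqrt ((sin \<alpha>)\<^sup>2 - (g \<beta>)\<^sup>2) * (sin \<alpha> * cos \<beta>) = g \<beta> ^ (2 * m)"
          using s c by simp
        thus ?thesis using True by (simp add: g_def power_mult_distrib)
      qed simp
    qed
  qed
  also have "\<dots> = ennreal (sin \<alpha> ^ (2 * m) * (pi / 2 * central_coeff m))"
  proof (rule nn_integral_has_integral_lebesgue')
    show "((\<lambda>\<beta>. sin \<alpha> ^ (2 * m) * sin \<beta> ^ (2 * m)) has_integral
             sin \<alpha> ^ (2 * m) * (pi / 2 * central_coeff m)) {0..pi/2}"
      by (intro has_integral_mult_right has_integral_sin_power)
  qed (simp add: power_mult)
  finally show ?thesis .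
qed

text \<open>
  Interchanging the integrals over \<open>u\<close> and \<open>\<alpha>\<close> and substituting \<open>u = sin \<alpha> * sin \<beta>\<close> gives
  \<open>\<integral>\<integral> (sin \<alpha> * sin \<beta>) ^ (2m) d\<alpha> d\<beta>\<close>, which factors.
\<close>

lemma complementary_K_moment:
  "(\<integral>\<^sup>+u. complementary_K u * ennreal (u ^ (2 * m)) * indicator {0..1} u \<partial>lborel) = ennreal ((pi / 2 * central_coeff m)\<^sup>2)"
proof -
  define h where "h = (\<lambda>u \<alpha>. ennreal (u ^ (2 * m) / sqrt ((sin \<alpha>)\<^sup>2 - u\<^sup>2)) *
                   (if 0 \<le> u \<and> u \<le> sin \<alpha> \<and> 0 \<le> \<alpha> \<and> \<alpha> \<le> pi / 2 then 1 else 0))"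
  have [measurable]: "case_prod h \<in> borel_measurable (lborel \<Otimes>\<^sub>M lborel)"
    unfolding h_def by measurable
  have "(\<integral>\<^sup>+u. complementary_K u * ennreal (u ^ (2 * m)) * indicator {0..1} u \<partial>lborel) =
        (\<integral>\<^sup>+u. (\<integral>\<^sup>+\<alpha>. h u \<alpha> \<partial>lborel) \<partial>lborel)"
  proof (rule nn_integral_cong_AE)
    have "AE u in lborel. u \<noteq> (0::real)" "AE u in lborel. u \<noteq> (1::real)" by (rule AE_lborel_singleton)+
    thus "AE u in lborel. complementary_K u * ennreal (u ^ (2 * m)) * indicator {0..1} u = (\<integral>\<^sup>+\<alpha>. h u \<alpha> \<partial>lborel)"
    proof eventually_elim
      case (elim u)
      show ?case
      proof (cases "u \<in> {0..1}")
        case True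
        hence u: "0 < u" "u < 1" using elim by auto
        have "complementary_K u * ennreal (u ^ (2 * m)) * indicator {0..1} u = ennreal (u ^ (2 * m)) * complementary_K u"
          using True by (simp add: mult.commute)
        also have "\<dots> = (\<integral>\<^sup>+\<alpha>. ennreal (u ^ (2 * m)) * (ennreal (1 / sqrt ((sin \<alpha>)\<^sup>2 - u\<^sup>2)) * indicator {\<alpha>\<in>{0..pi/2}. u \<le> sin \<alpha>} \<alpha>) \<partial>lborel)"
          unfolding complementary_K_as_sine_integral[OF u] by (subst nn_integral_cmult) auto
        also have "\<dots> = (\<integral>\<^sup>+\<alpha>. h u \<alpha> \<partial>lborel)"
          using u by (intro nn_integral_cong) (auto simp: h_def indicator_def ennreal_mult' [symmetric])
        finally show ?thesis .
      next
        case False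
        have "h u \<alpha> = 0" for \<alpha>
          using False sin_le_one[of \<alpha>] unfolding h_def by (auto simp: indicator_def simp del: sin_le_one)
        thus ?thesis using False by simp
      qed
    qed
  qed
  also have "\<dots> = (\<integral>\<^sup>+\<alpha>. (\<integral>\<^sup>+u. h u \<alpha> \<partial>lborel) \<partial>lborel)"
    by (rule lborel_pair.Fubini') measurable
  also have "\<dots> = (\<integral>\<^sup>+\<alpha>. ennreal (sin \<alpha> ^ (2 * m) * (pi / 2 * central_coeff m)) * indicator {0..pi/2} \<alpha> \<partial>lborel)"
  proof (rule nn_integral_cong_AE)
    have "AE \<alpha> in lborel. \<alpha> \<noteq> (0::real)" by (rule AE_lborel_singleton)
    thus "AE \<alpha> in lborel. (\<integral>\<^sup>+u. h u \<alpha> \<partial>lborel) = ennreal (sin \<alpha> ^ (2 * m) * (pi / 2 * central_coeff m)) * indicator {0..pi/2} \<alpha>"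
    proof eventually_elim
      case (elim \<alpha>)
      show ?case
      proof (cases "\<alpha> \<in> {0..pi/2}")
        case True
        hence "(\<integral>\<^sup>+u. h u \<alpha> \<partial>lborel) =
          (\<integral>\<^sup>+u. ennreal (u ^ (2 * m) / sqrt ((sin \<alpha>)\<^sup>2 - u\<^sup>2)) * indicator {0..sin \<alpha>} u \<partial>lborel)"
          by (intro nn_integral_cong) (auto simp: h_def indicator_def)
        thus ?thesis
          using True elim by (simp add: nn_integral_even_power_over_sqrt)
      qed (auto simp: h_def)
    qed
  qed
  also have "\<dots> = ennreal (pi / 2 * central_coeff m * (pi / 2 * central_coeff m))"
    using central_coeff_pos[of m]
    by (intro nn_integral_has_integral_lebesgue' has_integral_mult_left has_integral_sin_power)
       (auto simp: power_mult)
  finally show ?thesis by (simp add: power2_eq_square)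
qed

section \<open>Integration against the Legendre kernel\<close>

lemma central_coeff_even_sums:
  fixes x :: real
  assumes "\<bar>x\<bar> < 1"
  shows "(\<lambda>m. 2 * central_coeff (2 * m) * x ^ (2 * m)) sums (1 / sqrt (1 - x) + 1 / sqrt (1 + x))"
proof -
  have "(\<lambda>n. central_coeff n * x ^ n + central_coeff n * (-x) ^ n) sums (1 / sqrt (1 - x) + 1 / sqrt (1 - (-x)))"
    using assms by (intro sums_add central_coeff_sums) auto
  hence "(\<lambda>m. central_coeff (2 * m) * x ^ (2 * m) + central_coeff (2 * m) * (-x) ^ (2 * m)) sums
           (1 / sqrt (1 - x) + 1 / sqrt (1 - (-x)))"
  proof (subst sums_mono_reindex)
    show "strict_mono (\<lambda>m::nat. 2 * m)" by (simp add: strict_mono_def)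
    fix n assume "n \<notin> range (\<lambda>m::nat. 2 * m)"
    hence "odd n" by (auto elim!: evenE)
    thus "central_coeff n * x ^ n + central_coeff n * (-x) ^ n = 0" by simp
  qed
  thus ?thesis by (simp add: mult.assoc)
qed

text \<open>
  Here \<open>q\<close> is the Legendre kernel. In \<open>q u + q (-u)\<close> the odd powers of \<open>u\<close> cancel and the even ones
  have nonnegative coefficients, so monotone convergence reduces everything to the moments.
\<close>

lemma nn_integral_complementary_K_generating:
  fixes a :: real
  assumes a: "0 \<le> a" "a \<le> 1"
  defines "w \<equiv> a\<^sup>2"
  defines "q \<equiv> (\<lambda>u. 1 / sqrt (1 - 2 * u * a + w))"
  shows "(\<integral>\<^sup>+u. complementary_K u * ennreal (q u + q (-u)) * indicator {0..1} u \<partial>lborel) =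
         ennreal (2 * ((pi / 2)\<^sup>2 * ((\<Sum>m. moment_coeff m * (w / (1 + w)\<^sup>2) ^ m) / sqrt (1 + w))))"
proof -
  have w: "w \<ge> 0" by (simp add: w_def)
  define t where "t = 2 * a / (1 + w)"
  have t: "0 \<le> t" "t \<le> 1"
  proof -
    have "0 \<le> (1 - a)\<^sup>2" by simp
    hence "2 * a \<le> 1 + w" by (simp add: w_def power2_eq_square algebra_simps)
    thus "0 \<le> t" "t \<le> 1" using a w by (auto simp: t_def)
  qed
  have t2: "t\<^sup>2 = 4 * (w / (1 + w)\<^sup>2)"
    by (simp add: t_def w_def power_divide power_mult_distrib)
  define C where "C = (\<lambda>m. 2 / sqrt (1 + w) * central_coeff (2 * m) * t ^ (2 * m))"
  have C: "C m \<ge> 0" for m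
    using central_coeff_pos[of "2 * m"] t w by (simp add: C_def)
  have q_sums: "(\<lambda>m. C m * u ^ (2 * m)) sums (q u + q (-u))" if u: "0 \<le> u" "u < 1" for u
  proof -
    have "t * u \<le> 1 * u" using t u by (intro mult_right_mono) auto
    hence tu: "\<bar>t * u\<bar> < 1" using t u by simp
    have "1 - 2 * u * a + w = (1 + w) * (1 - t * u)" "1 - 2 * (-u) * a + w = (1 + w) * (1 + t * u)"
      using w by (simp_all add: t_def field_simps)
    hence "q u + q (-u) = 1 / sqrt (1 + w) * (1 / sqrt (1 - t * u) + 1 / sqrt (1 + t * u))"
      unfolding q_def by (simp only: real_sqrt_mult) (simp add: add_divide_distrib mult.commute)
    thus ?thesis
      using sums_mult[OF central_coeff_even_sums[OF tu], of "1 / sqrt (1 + w)"]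
      by (simp add: C_def power_mult_distrib mult_ac)
  qed
  have "(\<integral>\<^sup>+u. complementary_K u * ennreal (q u + q (-u)) * indicator {0..1} u \<partial>lborel) =
        (\<integral>\<^sup>+u. (\<Sum>m. ennreal (C m) * (complementary_K u * ennreal (u ^ (2 * m)) * indicator {0..1} u)) \<partial>lborel)"
  proof (rule nn_integral_cong_AE)
    have "AE u in lborel. u \<noteq> (1::real)" by (rule AE_lborel_singleton)
    thus "AE u in lborel. complementary_K u * ennreal (q u + q (-u)) * indicator {0..1} u =
             (\<Sum>m. ennreal (C m) * (complementary_K u * ennreal (u ^ (2 * m)) * indicator {0..1} u))"
    proof eventually_elim
      case (elim u)
      show ?case
      proof (cases "u \<in> {0..1}")
        case True
        hence S: "(\<lambda>m. C m * u ^ (2 * m)) sums (q u + q (-u))" using elim by (intro q_sums) auto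
        have "(\<Sum>m. ennreal (C m) * (complementary_K u * ennreal (u ^ (2 * m)) * indicator {0..1} u)) =
              (\<Sum>m. complementary_K u * ennreal (C m * u ^ (2 * m)))"
          using True C by (intro suminf_cong) (simp add: ennreal_mult mult_ac)
        also have "\<dots> = complementary_K u * (\<Sum>m. ennreal (C m * u ^ (2 * m)))"
          by (rule ennreal_suminf_cmult)
        also have "(\<Sum>m. ennreal (C m * u ^ (2 * m))) = ennreal (q u + q (-u))"
          using S C True by (subst suminf_ennreal2) (auto simp: sums_iff)
        finally show ?thesis using True by simp
      qed simp
    qed
  qed
  also have "\<dots> = (\<Sum>m. \<integral>\<^sup>+u. ennreal (C m) * (complementary_K u * ennreal (u ^ (2 * m)) * indicator {0..1} u) \<partial>lborel)"
    by (rule nn_integral_suminf) measurable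
  also have "\<dots> = (\<Sum>m. ennreal (C m) * ennreal ((pi / 2 * central_coeff m)\<^sup>2))"
    by (subst nn_integral_cmult) (simp_all add: complementary_K_moment)
  also have "\<dots> = (\<Sum>m. ennreal (2 * (pi / 2)\<^sup>2 / sqrt (1 + w) * (moment_coeff m * (w / (1 + w)\<^sup>2) ^ m)))"
  proof (rule suminf_cong)
    fix m
    have tm: "t ^ (2 * m) = 4 ^ m * (w / (1 + w)\<^sup>2) ^ m"
      by (simp only: power_mult t2 power_mult_distrib)
    have "C m * (pi / 2 * central_coeff m)\<^sup>2 = 2 * (pi / 2)\<^sup>2 / sqrt (1 + w) * (moment_coeff m * (w / (1 + w)\<^sup>2) ^ m)"
      unfolding C_def moment_coeff_def tm power_mult_distrib by simp
    thus "ennreal (C m) * ennreal ((pi / 2 * central_coeff m)\<^sup>2) =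
          ennreal (2 * (pi / 2)\<^sup>2 / sqrt (1 + w) * (moment_coeff m * (w / (1 + w)\<^sup>2) ^ m))"
      using C by (simp only: ennreal_mult [symmetric] zero_le_power2)
  qed
  also have "\<dots> = ennreal (\<Sum>m. 2 * (pi / 2)\<^sup>2 / sqrt (1 + w) * (moment_coeff m * (w / (1 + w)\<^sup>2) ^ m))"
  proof (rule suminf_ennreal2)
    show "summable (\<lambda>m. 2 * (pi / 2)\<^sup>2 / sqrt (1 + w) * (moment_coeff m * (w / (1 + w)\<^sup>2) ^ m))"
      by (intro summable_mult summable_comparison_test'[OF summable_moment_coeff moment_series_bound] w)
    show "0 \<le> 2 * (pi / 2)\<^sup>2 / sqrt (1 + w) * (moment_coeff m * (w / (1 + w)\<^sup>2) ^ m)" for m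
      using w moment_coeff_nonneg[of m] by simp
  qed
  also have "(\<Sum>m. 2 * (pi / 2)\<^sup>2 / sqrt (1 + w) * (moment_coeff m * (w / (1 + w)\<^sup>2) ^ m)) =
             2 * ((pi / 2)\<^sup>2 * ((\<Sum>m. moment_coeff m * (w / (1 + w)\<^sup>2) ^ m) / sqrt (1 + w)))"
  proof -
    have "summable (\<lambda>m. moment_coeff m * (w / (1 + w)\<^sup>2) ^ m)"
      by (rule summable_comparison_test'[OF summable_moment_coeff moment_series_bound[OF w]])
    thus ?thesis by (subst suminf_mult) simp_all
  qed
  finally show ?thesis .
qed

lemma nn_integral_symmetrize:
  fixes f :: "real \<Rightarrow> ennreal"
  assumes [measurable]: "f \<in> borel_measurable borel"
  shows "(\<integral>\<^sup>+x. f (2 * x - 1) * indicator {0..1} x \<partial>lborel) =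
         ennreal (1/2) * (\<integral>\<^sup>+u. (f u + f (-u)) * indicator {0..1} u \<partial>lborel)"
proof -
  have "(\<integral>\<^sup>+x. f (2 * x - 1) * indicator {0..1} x \<partial>lborel) =
        ennreal \<bar>1/2\<bar> * (\<integral>\<^sup>+u. f (2 * (1/2 + 1/2 * u) - 1) * indicator {0..1} (1/2 + 1/2 * u) \<partial>lborel)"
    by (rule nn_integral_real_affine) auto
  also have "(\<integral>\<^sup>+u. f (2 * (1/2 + 1/2 * u) - 1) * indicator {0..1} (1/2 + 1/2 * u) \<partial>lborel) =
             (\<integral>\<^sup>+u. f u * indicator {0..1} u + f u * indicator {-1..0} u \<partial>lborel)"
  proof (rule nn_integral_cong_AE)
    have "AE u in lborel. u \<noteq> (0::real)" by (rule AE_lborel_singleton)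
    thus "AE u in lborel. f (2 * (1/2 + 1/2 * u) - 1) * indicator {0..1} (1/2 + 1/2 * u) =
            f u * indicator {0..1} u + f u * indicator {-1..0} u"
      by eventually_elim (auto simp: indicator_def)
  qed
  also have "\<dots> = (\<integral>\<^sup>+u. f u * indicator {0..1} u \<partial>lborel) + (\<integral>\<^sup>+u. f u * indicator {-1..0} u \<partial>lborel)"
    by (rule nn_integral_add) auto
  also have "(\<integral>\<^sup>+u. f u * indicator {-1..0} u \<partial>lborel) =
             ennreal \<bar>-1\<bar> * (\<integral>\<^sup>+u. f (0 + (-1) * u) * indicator {-1..0} (0 + (-1) * u) \<partial>lborel)"
    by (rule nn_integral_real_affine) auto
  also have "\<dots> = (\<integral>\<^sup>+u. f (-u) * indicator {0..1} u \<partial>lborel)"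
    by (auto intro!: nn_integral_cong simp: indicator_def)
  also have "(\<integral>\<^sup>+u. f u * indicator {0..1} u \<partial>lborel) + (\<integral>\<^sup>+u. f (-u) * indicator {0..1} u \<partial>lborel) =
             (\<integral>\<^sup>+u. (f u + f (-u)) * indicator {0..1} u \<partial>lborel)"
    by (subst nn_integral_add [symmetric]) (auto simp: distrib_right)
  finally show ?thesis by simp
qed

theorem mainTheorem1:
  fixes a :: real
  assumes "a \<in> {0..1}"
  shows "((\<lambda>x::real. ellipticK (complex_of_real (2 * sqrt (x * (1 - x))))
              / complex_of_real (sqrt (1 - 2 * (2 * x - 1) * a + a\<^sup>2)))
           has_integral
             (ellipticK (csqrt (complex_of_real ((1 - sqrt (1 + a\<^sup>2)) / 2))))\<^sup>2) {0..1}"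
proof -
  have a: "0 \<le> a" "a \<le> 1" using assms by auto
  define w where "w = a\<^sup>2"
  have w: "0 \<le> w" "w \<le> 1" using a by (auto simp: w_def power_le_one)
  define z where "z = (1 - sqrt (1 + w)) / 2"
  define R where "R = (pi / 2)\<^sup>2 * ((\<Sum>m. moment_coeff m * (w / (1 + w)\<^sup>2) ^ m) / sqrt (1 + w))"
  have R: "R = (pi / 2 * (\<Sum>n. (central_coeff n)\<^sup>2 * z ^ n))\<^sup>2"
    unfolding R_def z_def moment_series_eq_square[OF w] power_mult_distrib ..
  have K: "ellipticK (csqrt (complex_of_real z)) = of_real (pi / 2 * (\<Sum>n. (central_coeff n)\<^sup>2 * z ^ n))"
  proof (rule ellipticK_series)
    have "sqrt (1 + w) \<ge> 1" using w by simp
    moreover have "sqrt (1 + w) \<le> sqrt 4" using w by (intro real_sqrt_le_mono) auto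
    ultimately show "\<bar>z\<bar> < 1" by (simp add: z_def)
  qed simp

  define q where "q = (\<lambda>u. 1 / sqrt (1 - 2 * u * a + w))"
  have q_nonneg: "q u \<ge> 0" if "\<bar>u\<bar> \<le> 1" for u
  proof -
    have "(u - a)\<^sup>2 \<ge> 0" "u\<^sup>2 \<le> 1" using that by (simp_all add: abs_square_le_1)
    hence "1 - 2 * u * a + w \<ge> 0" by (simp add: w_def power2_eq_square algebra_simps)
    thus ?thesis by (simp add: q_def)
  qed
  have [measurable]: "q \<in> borel_measurable borel"
    unfolding q_def by measurable
  have "(\<integral>\<^sup>+x. complementary_K (2 * x - 1) * ennreal (q (2 * x - 1)) * indicator {0..1} x \<partial>lborel) =
        ennreal (1/2) * (\<integral>\<^sup>+u. (complementary_K u * ennreal (q u) + complementary_K (-u) * ennreal (q (-u))) * indicator {0..1} u \<partial>lborel)"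
    by (rule nn_integral_symmetrize) measurable
  also have "(\<integral>\<^sup>+u. (complementary_K u * ennreal (q u) + complementary_K (-u) * ennreal (q (-u))) * indicator {0..1} u \<partial>lborel) =
        (\<integral>\<^sup>+u. complementary_K u * ennreal (q u + q (-u)) * indicator {0..1} u \<partial>lborel)"
    using q_nonneg by (intro nn_integral_cong) (auto simp: indicator_def distrib_left)
  also have "\<dots> = ennreal (2 * R)"
    unfolding q_def w_def R_def by (rule nn_integral_complementary_K_generating[OF a])
  also have "ennreal (1/2) * ennreal (2 * R) = ennreal R"
    by (subst ennreal_mult [symmetric]) (simp_all add: R)
  finally have I: "(\<integral>\<^sup>+x. complementary_K (2 * x - 1) * ennreal (q (2 * x - 1)) * indicator {0..1} x \<partial>lborel) = ennreal R" .

  define F where "F = (\<lambda>x. enn2real (complementary_K (2 * x - 1)) * q (2 * x - 1))"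
  \<comment> \<open>At \<open>x = 1/2\<close> the modulus is 1 and \<open>ellipticK\<close> takes the default value of a divergent integral;
      this single point is negligible.\<close>
  have K_F: "ellipticK (complex_of_real (2 * sqrt (x * (1 - x)))) = of_real (enn2real (complementary_K (2 * x - 1)))"
    and finite: "complementary_K (2 * x - 1) < top" if x: "x \<in> {0..1}" "x \<noteq> 1/2" for x
  proof -
    have u: "2 * x - 1 \<noteq> 0" using x by simp
    have "(2 * sqrt (x * (1 - x)))\<^sup>2 = 1 - (2 * x - 1)\<^sup>2"
      using x by (simp add: power_mult_distrib) (simp add: power2_eq_square algebra_simps)
    hence k: "(complex_of_real (2 * sqrt (x * (1 - x))))\<^sup>2 = of_real (1 - (2 * x - 1)\<^sup>2)"
      by (simp only: of_real_power [symmetric])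
    note * = complementary_K_eq_ellipticK[OF k u]
    have "1 - (2 * x - 1)\<^sup>2 < 1" using u by simp
    from ellipticK_eq_of_real(2)[OF k this] *
    show "ellipticK (complex_of_real (2 * sqrt (x * (1 - x)))) = of_real (enn2real (complementary_K (2 * x - 1)))"
      by (metis enn2real_ennreal)
    show "complementary_K (2 * x - 1) < top" by (simp add: *(1))
  qed
  have "(\<integral>\<^sup>+x. ennreal (F x * indicator {0..1} x) \<partial>lborel) = ennreal R"
    unfolding I [symmetric]
  proof (rule nn_integral_cong_AE)
    have "AE x in lborel. x \<noteq> (1/2 :: real)" by (rule AE_lborel_singleton)
    thus "AE x in lborel. ennreal (F x * indicator {0..1} x) =
            complementary_K (2 * x - 1) * ennreal (q (2 * x - 1)) * indicator {0..1} x"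
    proof eventually_elim
      case (elim x)
      show ?case
      proof (cases "x \<in> {0..1}")
        case True
        have "q (2 * x - 1) \<ge> 0" using True by (intro q_nonneg) auto
        thus ?thesis
          using True finite[OF True elim] by (simp add: F_def ennreal_mult ennreal_enn2real)
      qed simp
    qed
  qed
  moreover have "F x * indicator {0..1} x \<ge> 0" for x
    using q_nonneg[of "2 * x - 1"] by (auto simp: F_def indicator_def intro!: mult_nonneg_nonneg)
  moreover have "(\<lambda>x. F x * indicator {0..1} x) \<in> borel_measurable borel"
    unfolding F_def by measurable
  ultimately have "((\<lambda>x. F x * indicator {0..1} x) has_integral R) UNIV"
    by (intro nn_integral_has_integral) (auto simp: R)
  also have "(\<lambda>x. F x * indicator {0..1} x) = (\<lambda>x. if x \<in> {0..1} then F x else 0)"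
    by (auto simp: indicator_def)
  finally have "(F has_integral R) {0..1}"
    by (simp only: has_integral_restrict_UNIV)
  hence "((\<lambda>x. complex_of_real (F x)) has_integral of_real R) {0..1}"
    by (rule has_integral_of_real)
  hence "((\<lambda>x::real. ellipticK (complex_of_real (2 * sqrt (x * (1 - x))))
              / complex_of_real (sqrt (1 - 2 * (2 * x - 1) * a + a\<^sup>2))) has_integral of_real R) {0..1}"
  proof (rule has_integral_spike_finite[where S = "{1/2}", rotated 2])
    fix x :: real assume x: "x \<in> {0..1} - {1/2}"
    show "ellipticK (complex_of_real (2 * sqrt (x * (1 - x))))
              / complex_of_real (sqrt (1 - 2 * (2 * x - 1) * a + a\<^sup>2)) = complex_of_real (F x)"
    proof -
      have "x \<in> {0..1}" "x \<noteq> 1/2" using x by auto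
      from K_F[OF this] show ?thesis by (simp only:) (simp add: F_def q_def w_def)
    qed
  qed simp
  also have "complex_of_real R = (ellipticK (csqrt (complex_of_real z)))\<^sup>2"
    by (simp only: K R of_real_power)
  finally show ?thesis
    unfolding z_def w_def .
qed

end
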